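(* Let $M=\mathbb{S}^2$. For each integer $l\ge 1$ let $$f_l(\theta,\varphi)=c_l\,e^{il\varphi}(\sin\theta)^l,$$ normalized (by the choice of the constant $c_l$) so that $\|f_l\|_{L^2(\mathbb{S}^2)}=1$. Then: (1) there exists a set $E_l\subset\mathbb{S}^2$ with $|E_l|\approx l^{-1/2}$ such that $\int_{E_l}|f_l(x)|^2\,dx\ge \tfrac12$; (2) $\sup_{x\in\mathbb{S}^2}|f_l(x)|^2\approx l^{1/2}$; (3) consequently, $|E_l|\cdot\sup_{x\in E_l}|f_l(x)|^2\approx 1$. In particular, the defect factor $$\sup_{x\in E}\frac{A_S(x)}{\#X_S/|M|}$$ in the general uncertainty inequality $$(1-\epsilon-\epsilon')^2\le\frac{|E|}{|M|}\cdot\#X_S\cdot\sup_{x\in E}\frac{A_S(x)}{\#X_S/|M|}$$ (whose setting is recalled in the context) cannot, in general, be replaced by any smaller-order quantity.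
   Context: $(\theta,\varphi)$ are spherical coordinates on the round sphere $\mathbb{S}^2$, with polar angle $\theta\in[0,\pi]$ and azimuthal angle $\varphi$; $dx$ is the Riemannian volume (surface) measure and $|\cdot|$ denotes the volume of a set. $A\approx B$ means $C^{-1}B\le A\le CB$ with a constant $C>0$ independent of $l$. Setting of the uncertainty inequality: $(M,g)$ is a compact Riemannian manifold without boundary, $\{e_j\}$ is an $L^2(M)$-orthonormal basis of Laplace eigenfunctions, $-\Delta_g e_j=\lambda_j^2e_j$, $\widehat f(j)=\langle f,e_j\rangle$, $E\subset M$ is measurable, $S$ is a finite subset of the spectrum, $X_S=\{j:\lambda_j\in S\}$, and $A_S(x)=\sum_{j\in X_S}|e_j(x)|^2$. The inequality holds for $f\in L^2(M)$ with $\int_E|f|^2\,dx\ge(1-\epsilon)\|f\|_{L^2(M)}^2$ and $\sum_{j\in X_S}|\widehat f(j)|^2\ge(1-\epsilon')\|f\|_{L^2(M)}^2$, where $0\le\epsilon,\epsilon'<1$ are small so that $0<1-\epsilon-\epsilon'\le1$. The same inequality is also used with $X_S$ replaced by an arbitrary finite index set $I$ and $A_S$ replaced by $A_I(x)=\sum_{j\in I}|e_j(x)|^2$ (partial spectral families inside a fixed eigenspace). *)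

theory Defs
  imports "HOL-Analysis.Analysis" "HOL-Library.Landau_Symbols"
begin

text \<open>The round sphere is \<^term>\<open>sphere (0 :: real^3) 1\<close>; functions on it are functions on
  \<open>real^3\<close> of which only the values on the sphere matter.\<close>

definition sph :: "real \<Rightarrow> real \<Rightarrow> real^3" where
  "sph \<theta> \<phi> = vector [sin \<theta> * cos \<phi>, sin \<theta> * sin \<phi>, cos \<theta>]"

text \<open>The Riemannian volume \<open>sin \<theta> d\<theta> d\<phi>\<close>, as a measure on the Borel subsets of the sphere.\<close>

definition S2 :: "(real^3) measure" where
  "S2 = distr
     (density (restrict_space lborel ({0..pi} \<times> {0..2 * pi})) (\<lambda>(\<theta>, \<phi>). ennreal (sin \<theta>)))
     (restrict_space borel (sphere 0 1))
     (\<lambda>(\<theta>, \<phi>). sph \<theta> \<phi>)"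

definition L2_fun :: "(real^3 \<Rightarrow> complex) \<Rightarrow> bool" where
  "L2_fun u \<longleftrightarrow> u \<in> borel_measurable S2 \<and> integrable S2 (\<lambda>x. (cmod (u x))\<^sup>2)"

definition L2_inner :: "(real^3 \<Rightarrow> complex) \<Rightarrow> (real^3 \<Rightarrow> complex) \<Rightarrow> complex" where
  "L2_inner u v = (LINT x|S2. u x * cnj (v x))"

definition L2_norm :: "(real^3 \<Rightarrow> complex) \<Rightarrow> real" where
  "L2_norm u = sqrt (LINT x|S2. (cmod (u x))\<^sup>2)"

text \<open>\<open>C_k_on k U F\<close>: all iterated directional derivatives of \<open>F\<close> of order at most \<open>k\<close> exist
  and are continuous on the open set \<open>U\<close>.\<close>

primrec C_k_on :: "nat \<Rightarrow> (real^3) set \<Rightarrow> (real^3 \<Rightarrow> complex) \<Rightarrow> bool" where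
  "C_k_on 0 U F \<longleftrightarrow> continuous_on U F"
| "C_k_on (Suc k) U F \<longleftrightarrow>
     F differentiable_on U \<and> (\<forall>v. C_k_on k U (\<lambda>x. frechet_derivative F (at x) v))"

definition smooth_on_sphere :: "(real^3 \<Rightarrow> complex) \<Rightarrow> bool" where
  "smooth_on_sphere u \<longleftrightarrow>
     (\<exists>U F. open U \<and> sphere 0 1 \<subseteq> U \<and> (\<forall>k. C_k_on k U F) \<and> (\<forall>x\<in>sphere 0 1. F x = u x))"

text \<open>The Laplace--Beltrami operator of the metric \<open>d\<theta>\<^sup>2 + sin\<^sup>2 \<theta> d\<phi>\<^sup>2\<close>, evaluated at the
  point with coordinates \<open>(\<theta>, \<phi>)\<close>, \<open>0 < \<theta> < pi\<close>.\<close>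

definition sphere_laplacian :: "(real^3 \<Rightarrow> complex) \<Rightarrow> real \<Rightarrow> real \<Rightarrow> complex" where
  "sphere_laplacian u \<theta> \<phi> =
     (1 / sin \<theta>) *\<^sub>R
       vector_derivative (\<lambda>t. sin t *\<^sub>R vector_derivative (\<lambda>s. u (sph s \<phi>)) (at t)) (at \<theta>)
     + (1 / (sin \<theta>)\<^sup>2) *\<^sub>R
       vector_derivative (\<lambda>t. vector_derivative (\<lambda>s. u (sph \<theta> s)) (at t)) (at \<phi>)"

text \<open>The equation is only imposed away from the poles, where the coordinates are regular.  At the
  poles it then holds by continuity, because \<open>u\<close> is required to be smooth on the whole sphere;
  without that requirement functions singular at the poles would be admitted.\<close>

definition laplace_eigenfunction :: "real \<Rightarrow> (real^3 \<Rightarrow> complex) \<Rightarrow> bool" where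
  "laplace_eigenfunction \<mu> u \<longleftrightarrow>
     smooth_on_sphere u \<and>
     (\<forall>\<theta>\<in>{0<..<pi}. \<forall>\<phi>. - sphere_laplacian u \<theta> \<phi> = of_real (\<mu>\<^sup>2) * u (sph \<theta> \<phi>))"

definition orthonormal_basis :: "(nat \<Rightarrow> real^3 \<Rightarrow> complex) \<Rightarrow> bool" where
  "orthonormal_basis e \<longleftrightarrow>
     (\<forall>j. L2_fun (e j)) \<and>
     (\<forall>j k. L2_inner (e j) (e k) = (if j = k then 1 else 0)) \<and>
     (\<forall>u. L2_fun u \<longrightarrow>
        (\<lambda>n. L2_norm (\<lambda>x. u x - (\<Sum>j<n. L2_inner u (e j) * e j x))) \<longlonglongrightarrow> 0)"

definition laplace_eigenbasis :: "(nat \<Rightarrow> real^3 \<Rightarrow> complex) \<Rightarrow> (nat \<Rightarrow> real) \<Rightarrow> bool" where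
  "laplace_eigenbasis e \<mu> \<longleftrightarrow>
     orthonormal_basis e \<and> (\<forall>j. 0 \<le> \<mu> j \<and> laplace_eigenfunction (\<mu> j) (e j))"

definition spectral_density :: "(nat \<Rightarrow> real^3 \<Rightarrow> complex) \<Rightarrow> nat set \<Rightarrow> real^3 \<Rightarrow> real" where
  "spectral_density e I x = (\<Sum>j\<in>I. (cmod (e j x))\<^sup>2)"

definition defect_factor ::
    "(nat \<Rightarrow> real^3 \<Rightarrow> complex) \<Rightarrow> nat set \<Rightarrow> (real^3) set \<Rightarrow> real" where
  "defect_factor e I E =
     (SUP x\<in>E. spectral_density e I x / (real (card I) / measure S2 (space S2)))"

text \<open>\<open>uncertainty_inequality e D\<close> says that the uncertainty inequality for the basis \<open>e\<close> is valid
  with the quantity \<open>D I E\<close> in the place of the factor \<open>defect_factor e I E\<close>.  The function \<open>u\<close> has to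
  be nonzero: for \<open>u = 0\<close> and null sets \<open>E\<close> the inequality always fails.\<close>

definition uncertainty_inequality ::
    "(nat \<Rightarrow> real^3 \<Rightarrow> complex) \<Rightarrow> (nat set \<Rightarrow> (real^3) set \<Rightarrow> real) \<Rightarrow> bool" where
  "uncertainty_inequality e D \<longleftrightarrow>
     (\<forall>I E u \<epsilon> \<epsilon>'.
        finite I \<and> E \<in> sets S2 \<and> L2_fun u \<and> L2_norm u \<noteq> 0 \<and>
        0 \<le> \<epsilon> \<and> \<epsilon> < 1 \<and> 0 \<le> \<epsilon>' \<and> \<epsilon>' < 1 \<and> 0 < 1 - \<epsilon> - \<epsilon>' \<and> 1 - \<epsilon> - \<epsilon>' \<le> 1 \<and>
        (LINT x:E|S2. (cmod (u x))\<^sup>2) \<ge> (1 - \<epsilon>) * (L2_norm u)\<^sup>2 \<and>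
        (\<Sum>j\<in>I. (cmod (L2_inner u (e j)))\<^sup>2) \<ge> (1 - \<epsilon>') * (L2_norm u)\<^sup>2
        \<longrightarrow> (1 - \<epsilon> - \<epsilon>')\<^sup>2 \<le>
              measure S2 E / measure S2 (space S2) * real (card I) * D I E)"

definition comparable :: "(nat \<Rightarrow> real) \<Rightarrow> (nat \<Rightarrow> real) \<Rightarrow> bool" where
  "comparable A B \<longleftrightarrow> (\<exists>C>0. \<forall>l\<ge>1. inverse C * B l \<le> A l \<and> A l \<le> C * B l)"

end

theory Submission
  imports Defs "HOL-Library.Nat_Bijection"
begin

text \<open>On the sphere \<open>f l\<close> is \<open>c l\<close> times \<open>(x + iy)\<^sup>l\<close>, so \<open>\<bar>f l\<bar>\<^sup>2 = \<bar>c l\<bar>\<^sup>2 (1 - z\<^sup>2)\<^sup>l\<close> depends on the height \<open>z\<close>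
  only and is largest, equal to \<open>\<bar>c l\<bar>\<^sup>2\<close>, on the equator.  By Archimedes' hat-box theorem the band
  \<open>\<bar>z\<bar> \<le> a\<close> has area \<open>4 pi a\<close>.  The density \<open>(1 - z\<^sup>2)\<^sup>l\<close> has the exact variance \<open>1 / (2 l + 3)\<close>, so by
  Chebyshev's inequality at least half of the mass lies in the band \<open>E l\<close> given by \<open>\<bar>z\<bar> \<le> 1 / sqrt l\<close>, of area
  \<open>4 pi / sqrt l\<close> (\<open>zonal_power_mass_band\<close>).  The density is at most 1, and at least \<open>1/2\<close> on half that
  band, so its total mass is of the order of \<open>1 / sqrt l\<close> (\<open>zonal_power_mass_upper\<close>,
  \<open>zonal_power_mass_lower\<close>), and \<open>\<bar>c l\<bar>\<^sup>2\<close> is of the order of \<open>sqrt l\<close>.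

  For the sharpness, let \<open>f l\<close> be a member of an orthonormal basis of eigenfunctions and take \<open>I\<close> to
  consist of its index alone.  For \<open>u = f l\<close>, \<open>E = E l\<close>, \<open>\<epsilon> = 1/2\<close> and \<open>\<epsilon>' = 0\<close> the left-hand side of the
  uncertainty inequality is \<open>1/4\<close>, while the area of \<open>E l\<close> times the defect factor stays bounded.
  A quantity of smaller order in place of the defect factor sends the right-hand side to 0.

  It remains to complete the functions \<open>f l\<close> to an eigenbasis (\<open>harmonic_eigenbasis\<close>).  The spherical
  harmonics are \<open>e\<^sup>i\<^sup>m\<^sup>\<phi> sin\<^sup>M \<theta> p(cos \<theta>)\<close> with \<open>M = \<bar>m\<bar>\<close>, where \<open>p\<close> is the \<open>(2 M + k)\<close>-th derivative of
  \<open>(1 - t\<^sup>2)\<^sup>M\<^sup>+\<^sup>k\<close>; the case \<open>k = 0\<close>, \<open>m = l\<close> is \<open>f l\<close> up to a constant.  Repeated differentiation of a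
  first-order equation gives the differential equation for \<open>p\<close> (\<open>iterated_pderiv_ode\<close>), which yields both the
  eigenvalue \<open>(M + k) (M + k + 1)\<close> (\<open>harmonic_eigenfunction\<close>) and orthogonality, through a Wronskian that
  vanishes at the poles (\<open>harmonic_orthogonal\<close>).  For completeness, the functions that are limits of
  their expansions form a space closed under \<open>L\<^sup>2\<close>-limits, so it is enough that polynomials belong to
  it (\<open>L2_density_induct\<close>, \<open>orthonormal_basisI\<close>); on the sphere every polynomial is a finite combination of
  the spherical harmonics (\<open>azimuthal_sum_polynomial\<close>).\<close>

section \<open>Integration in spherical coordinates\<close>

lemma sph_nth [simp]:
  "sph \<theta> \<phi> $ 1 = sin \<theta> * cos \<phi>" "sph \<theta> \<phi> $ 2 = sin \<theta> * sin \<phi>" "sph \<theta> \<phi> $ 3 = cos \<theta>"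
  by (simp_all add: sph_def)

lemma norm_eq_1_iff: "norm (x :: real^3) = 1 \<longleftrightarrow> (x $ 1)\<^sup>2 + (x $ 2)\<^sup>2 + (x $ 3)\<^sup>2 = 1"
  by (simp add: norm_eq_1 inner_vec_def sum_3 power2_eq_square)

lemma norm_sph [simp]: "norm (sph \<theta> \<phi>) = 1"
proof -
  have "(sin \<theta> * cos \<phi>)\<^sup>2 + (sin \<theta> * sin \<phi>)\<^sup>2 = (sin \<theta>)\<^sup>2"
    using sin_cos_squared_add[of \<phi>] by (simp add: power_mult_distrib flip: distrib_left)
  then show ?thesis by (simp add: norm_eq_1_iff)
qed

lemma sphere_cases:
  assumes "x \<in> sphere (0 :: real^3) 1"
  obtains \<theta> \<phi> where "\<theta> \<in> {0..pi}" "\<phi> \<in> {0..2 * pi}" "x = sph \<theta> \<phi>"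
proof -
  have sq: "(x $ 1)\<^sup>2 + (x $ 2)\<^sup>2 + (x $ 3)\<^sup>2 = 1"
    using assms by (simp add: norm_eq_1_iff)
  have "\<bar>x $ 3\<bar> \<le> 1"
    using sq by (intro abs_le_square_iff[THEN iffD2, of _ "1::real", simplified])
      (smt (verit) zero_le_power2)
  then have z: "-1 \<le> x $ 3" "x $ 3 \<le> 1" by auto
  define \<theta> where "\<theta> = arccos (x $ 3)"
  have th: "\<theta> \<in> {0..pi}" "cos \<theta> = x $ 3"
    using z by (auto simp: \<theta>_def arccos_lbound arccos_ubound)
  have ss: "(x $ 1)\<^sup>2 + (x $ 2)\<^sup>2 = (sin \<theta>)\<^sup>2"
    using sq th sin_cos_squared_add[of \<theta>] by simp
  have "\<exists>\<phi>\<in>{0..2 * pi}. x $ 1 = sin \<theta> * cos \<phi> \<and> x $ 2 = sin \<theta> * sin \<phi>"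
  proof (cases "sin \<theta> = 0")
    case True
    then have "x $ 1 = 0" "x $ 2 = 0" using ss by (simp_all add: sum_power2_eq_zero_iff)
    then show ?thesis using True by (intro bexI[of _ 0]) auto
  next
    case False
    have "(x $ 1 / sin \<theta>)\<^sup>2 + (x $ 2 / sin \<theta>)\<^sup>2 = 1"
      using ss False by (simp add: power_divide flip: add_divide_distrib)
    from sincos_total_2pi[OF this] obtain t where
      "0 \<le> t" "t < 2 * pi" "x $ 1 / sin \<theta> = cos t" "x $ 2 / sin \<theta> = sin t" .
    then show ?thesis using False by (intro bexI[of _ t]) (auto simp: field_simps)
  qed
  then obtain \<phi> where ph: "\<phi> \<in> {0..2 * pi}" "x $ 1 = sin \<theta> * cos \<phi>" "x $ 2 = sin \<theta> * sin \<phi>"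
    by blast
  have "x = sph \<theta> \<phi>"
    using th ph by (simp add: vec_eq_iff forall_3)
  with th ph show ?thesis using that by blast
qed

lemma continuous_on_sph: "continuous_on UNIV (\<lambda>p. sph (fst p) (snd p))"
  unfolding sph_def
  by (subst continuous_on_componentwise)
    (auto simp: Basis_vec_def inner_axis forall_3 intro!: continuous_intros)

lemma space_S2 [simp]: "space S2 = sphere 0 1"
  by (simp add: S2_def space_restrict_space)

lemma sets_S2 [measurable_cong]: "sets S2 = sets (restrict_space borel (sphere 0 1))"
  by (simp add: S2_def)

lemma measurable_S2_iff:
  "f \<in> borel_measurable S2 \<longleftrightarrow> f \<in> borel_measurable (restrict_space borel (sphere 0 1))"
  using measurable_cong_sets[OF sets_S2 refl] by auto

abbreviation chart :: "(real \<times> real) set" where "chart \<equiv> {0..pi} \<times> {0..2 * pi}"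

lemma measurable_sph:
  "(\<lambda>(\<theta>, \<phi>). sph \<theta> \<phi>) \<in> measurable (restrict_space lborel chart) (restrict_space borel (sphere 0 1))"
proof (rule measurable_restrict_space2)
  show "(\<lambda>(\<theta>, \<phi>). sph \<theta> \<phi>) \<in> borel_measurable (restrict_space lborel chart)"
    using borel_measurable_continuous_onI[OF continuous_on_sph]
    by (intro measurable_restrict_space1) (simp add: split_beta')
qed auto

lemma chart_borel [measurable]: "chart \<in> sets borel"
  by (intro borel_closed closed_Times) auto

lemma sin_measurable_chart [measurable]: "(\<lambda>p. sin (fst p)) \<in> borel_measurable (restrict_space lborel chart)"
  by (intro measurable_restrict_space1) (simp add: borel_measurable_continuous_onI continuous_intros)

lemma finite_measure_S2: "finite_measure S2"
proof
  have "emeasure S2 (space S2) =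
      (\<integral>\<^sup>+p. (case p of (\<theta>, \<phi>) \<Rightarrow> ennreal (sin \<theta>)) \<partial>restrict_space lborel chart)"
  proof -
    let ?R = "restrict_space lborel chart" and ?d = "\<lambda>p. ennreal (sin (fst p))"
    have "emeasure S2 (sphere 0 1) = emeasure (density ?R ?d) (space ?R)"
      unfolding S2_def using measurable_sph
      by (subst emeasure_distr)
        (auto simp: sets_restrict_space split_beta' intro!: arg_cong2[where f = emeasure])
    also have "\<dots> = (\<integral>\<^sup>+p. ?d p \<partial>?R)"
      by (subst emeasure_density[OF _ sets.top]) (auto intro!: nn_integral_cong simp: indicator_def)
    finally show ?thesis by (simp add: split_beta')
  qed
  also have "\<dots> \<le> (\<integral>\<^sup>+p. 1 \<partial>restrict_space lborel chart)"
    by (intro nn_integral_mono) (auto simp: split_beta' ennreal_le_1)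
  also have "\<dots> = emeasure lborel chart"
    by (simp add: emeasure_restrict_space space_restrict_space)
  also have "\<dots> = emeasure lborel (cbox (0::real, 0::real) (pi, 2 * pi))"
    by (simp add: cbox_Pair_eq)
  also have "\<dots> < \<infinity>"
    by (rule emeasure_lborel_cbox_finite)
  finally show "emeasure S2 (space S2) \<noteq> \<infinity>" by auto
qed

interpretation S2: finite_measure S2 by (rule finite_measure_S2)

lemma
  fixes u :: "real^3 \<Rightarrow> 'b :: {banach, second_countable_topology}"
  assumes u: "u \<in> borel_measurable S2"
  shows S2_integral_chart: "(LINT x|S2. u x) =
      (LINT p|lborel. indicator chart p *\<^sub>R (sin (fst p) *\<^sub>R u (sph (fst p) (snd p))))" (is ?A)
    and S2_integrable_chart: "integrable S2 u \<longleftrightarrow>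
      integrable lborel (\<lambda>p. indicator chart p *\<^sub>R (sin (fst p) *\<^sub>R u (sph (fst p) (snd p))))" (is ?B)
proof -
  have u': "u \<in> borel_measurable (restrict_space borel (sphere 0 1))"
    using u by (simp only: measurable_S2_iff)
  have m: "(\<lambda>p. sph (fst p) (snd p)) \<in>
      measurable (restrict_space lborel chart) (restrict_space borel (sphere 0 1))"
    using measurable_sph by (simp add: split_beta')
  have um: "(\<lambda>p. u (sph (fst p) (snd p))) \<in> borel_measurable (restrict_space lborel chart)"
    using measurable_compose[OF m u'] .
  have nn: "AE p in restrict_space lborel chart. 0 \<le> sin (fst p)"
    by (rule AE_I2) (auto simp: space_restrict_space intro!: sin_ge_zero)
  have m': "(\<lambda>p. sph (fst p) (snd p)) \<in>
      measurable (density (restrict_space lborel chart) (\<lambda>p. ennreal (sin (fst p)))) (restrict_space borel (sphere 0 1))"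
    using m by simp
  show ?A
    unfolding S2_def split_beta'
    by (subst integral_distr[OF m' u'], subst integral_density[OF um sin_measurable_chart nn],
        subst integral_restrict_space) auto
  show ?B
    unfolding S2_def split_beta'
    by (subst integrable_distr_eq[OF m' u'], subst integrable_density[OF um sin_measurable_chart nn],
        subst integrable_restrict_space) auto
qed

text \<open>Fubini's theorem in the chart; the density \<open>sin \<theta>\<close> joins the polar factor.\<close>

lemma S2_integral_separated:
  fixes u :: "real^3 \<Rightarrow> 'b :: {real_normed_field, banach, second_countable_topology}"
  assumes u: "integrable S2 u"
    and AB: "\<And>\<theta> \<phi>. \<theta> \<in> {0..pi} \<Longrightarrow> \<phi> \<in> {0..2 * pi} \<Longrightarrow> u (sph \<theta> \<phi>) = A \<theta> * B \<phi>"
  shows "(LINT x|S2. u x) = (LINT \<theta>:{0..pi}|lborel. sin \<theta> *\<^sub>R A \<theta>) * (LINT \<phi>:{0..2 * pi}|lborel. B \<phi>)"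
proof -
  let ?g = "\<lambda>p. indicator chart p *\<^sub>R (sin (fst p) *\<^sub>R u (sph (fst p) (snd p)))"
  have um: "u \<in> borel_measurable S2" using u by simp
  have int: "integrable (lborel \<Otimes>\<^sub>M lborel) ?g"
    using u S2_integrable_chart[OF um] by (simp add: lborel_prod)
  have g: "?g (\<theta>, \<phi>) = (indicator {0..pi} \<theta> *\<^sub>R sin \<theta> *\<^sub>R A \<theta>) * (indicator {0..2 * pi} \<phi> *\<^sub>R B \<phi>)" for \<theta> \<phi>
    using AB[of \<theta> \<phi>] by (auto simp: indicator_def)
  have "(LINT x|S2. u x) = (LINT p|(lborel \<Otimes>\<^sub>M lborel). ?g p)"
    by (simp only: S2_integral_chart[OF um] lborel_prod)
  also have "\<dots> = (LINT \<theta>|lborel. LINT \<phi>|lborel. ?g (\<theta>, \<phi>))"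
    using lborel_pair.integral_fst'[OF int] by simp
  also have "\<dots> = (LINT \<theta>:{0..pi}|lborel. sin \<theta> *\<^sub>R A \<theta>) * (LINT \<phi>:{0..2 * pi}|lborel. B \<phi>)"
    unfolding g set_lebesgue_integral_def
    by (simp only: integral_mult_right_zero integral_mult_left_zero)
  finally show ?thesis .
qed

lemma S2_integral_zonal:
  fixes h :: "real \<Rightarrow> real"
  assumes "integrable S2 (\<lambda>x. h (x $ 3))"
  shows "(LINT x|S2. h (x $ 3)) = 2 * pi * (LINT \<theta>:{0..pi}|lborel. sin \<theta> * h (cos \<theta>))"
proof -
  have "(LBINT \<phi>:{0..2 * pi}. (1::real)) = 2 * pi"
    by (simp add: set_lebesgue_integral_def)
  then show ?thesis
    using S2_integral_separated[OF assms, of "\<lambda>\<theta>. h (cos \<theta>)" "\<lambda>_. 1"] by simp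
qed

lemma continuous_imp_S2_measurable:
  assumes "continuous_on (sphere 0 1) u"
  shows "u \<in> borel_measurable S2"
  using assms by (simp only: measurable_S2_iff borel_measurable_continuous_on_restrict)

lemma continuous_imp_S2_integrable:
  fixes u :: "real^3 \<Rightarrow> 'b :: {banach, second_countable_topology}"
  assumes "continuous_on (sphere 0 1) u"
  shows "integrable S2 u"
proof -
  have "bounded (u ` sphere 0 1)"
    by (intro compact_imp_bounded compact_continuous_image assms compact_sphere)
  then obtain B where "\<And>x. x \<in> sphere 0 1 \<Longrightarrow> norm (u x) \<le> B"
    unfolding bounded_iff by blast
  then show ?thesis
    by (intro S2.integrable_const_bound[of _ B] continuous_imp_S2_measurable assms AE_I2)
      (simp del: mem_sphere_0)
qed

text \<open>Archimedes' hat-box theorem for polynomials: the height \<open>z = cos \<theta>\<close> is uniformly distributed, so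
  an integral over the sphere of a derivative in \<open>z\<close> sees only the two poles.  The orthogonality
  relations and the second moment are instances of this.\<close>

lemma S2_integral_zonal_pderiv:
  "(LINT x|S2. poly (pderiv g) (x $ 3)) = 2 * pi * (poly g 1 - poly g (-1))"
proof -
  have "(LINT \<theta>:{0..pi}|lborel. sin \<theta> * poly (pderiv g) (cos \<theta>)) = - poly g (cos pi) - - poly g (cos 0)"
    unfolding set_lebesgue_integral_def
    by (intro integral_FTC_Icc)
      (auto intro!: derivative_eq_intros continuous_intros simp flip: has_real_derivative_iff_has_vector_derivative)
  then show ?thesis
    by (subst S2_integral_zonal) (auto intro!: continuous_imp_S2_integrable continuous_intros)
qed

definition band :: "real \<Rightarrow> (real^3) set" where
  "band a = {x \<in> sphere 0 1. \<bar>x $ 3\<bar> \<le> a}"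

lemma band_sets: "band a \<in> sets S2"
proof -
  have "band a = sphere 0 1 \<inter> {x. \<bar>x $ 3\<bar> \<le> a}" by (auto simp: band_def)
  moreover have "{x :: real^3. \<bar>x $ 3\<bar> \<le> a} \<in> sets borel" 
    by (intro borel_closed closed_Collect_le continuous_intros)
  ultimately show ?thesis by (auto simp: sets_S2 sets_restrict_space)
qed

lemma measure_band:
  assumes a: "0 \<le> a" "a \<le> 1"
  shows "measure S2 (band a) = 4 * pi * a"
proof -
  have ind: "indicator (band a) x = (indicator {-a..a} (x $ 3) :: real)" if "x \<in> space S2" for x
    using that by (auto simp: band_def indicator_def)
  have "measure S2 (band a) = (LINT x|S2. indicator (band a) x)"
    using sets.sets_into_space[OF band_sets[of a]] by (simp add: Int_absorb2)
  also have "\<dots> = (LINT x|S2. indicator {-a..a} (x $ 3))"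
    by (intro Bochner_Integration.integral_cong refl ind)
  also have "\<dots> = 2 * pi * (LINT \<theta>:{0..pi}|lborel. sin \<theta> * indicator {-a..a} (cos \<theta>))"
  proof (rule S2_integral_zonal)
    have "integrable S2 (indicator (band a) :: _ \<Rightarrow> real)"
      using band_sets by (auto simp: S2.emeasure_finite less_top[symmetric])
    then show "integrable S2 (\<lambda>x. indicator {-a..a} (x $ 3) :: real)"
      by (subst (asm) Bochner_Integration.integrable_cong[OF refl ind])
  qed
  also have "(LINT \<theta>:{0..pi}|lborel. sin \<theta> * indicator {-a..a} (cos \<theta>)) =
      (LINT \<theta>|lborel. indicator {arccos a..arccos (-a)} \<theta> *\<^sub>R sin \<theta>)"
    unfolding set_lebesgue_integral_def
  proof (intro Bochner_Integration.integral_cong refl)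
    fix \<theta> :: real
    have iff: "\<theta> \<in> {0..pi} \<and> cos \<theta> \<in> {-a..a} \<longleftrightarrow> \<theta> \<in> {arccos a..arccos (-a)}"
    proof
      assume "\<theta> \<in> {0..pi} \<and> cos \<theta> \<in> {-a..a}"
      then show "\<theta> \<in> {arccos a..arccos (-a)}"
        using a arccos_le_arccos[of "cos \<theta>" a] arccos_le_arccos[of "-a" "cos \<theta>"]
        by (auto simp: arccos_cos)
    next
      assume t: "\<theta> \<in> {arccos a..arccos (-a)}"
      have "\<theta> \<in> {0..pi}"
        using t a arccos_lbound[of a] arccos_ubound[of "-a"] by auto
      moreover have "cos \<theta> \<le> cos (arccos a)" "cos (arccos (-a)) \<le> cos \<theta>"
        using t a \<open>\<theta> \<in> {0..pi}\<close>
        by (intro cos_monotone_0_pi_le; force intro: arccos_lbound arccos_ubound)+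
      ultimately show "\<theta> \<in> {0..pi} \<and> cos \<theta> \<in> {-a..a}" using a by auto
    qed
    then show "indicator {0..pi} \<theta> *\<^sub>R (sin \<theta> * indicator {-a..a} (cos \<theta>)) =
        indicator {arccos a..arccos (-a)} \<theta> *\<^sub>R sin \<theta>"
      by (auto simp: indicator_def)
  qed
  also have "\<dots> = - cos (arccos (-a)) - - cos (arccos a)"
    using a
    by (intro integral_FTC_Icc arccos_le_arccos)
      (auto intro!: derivative_eq_intros continuous_intros simp flip: has_real_derivative_iff_has_vector_derivative)
  also have "\<dots> = 2 * a" using a by simp
  finally show ?thesis by simp
qed

lemma measure_S2: "measure S2 (space S2) = 4 * pi"
proof -
  have "space S2 = band 1"
    by (auto simp: band_def) (metis component_le_norm_cart)
  then show ?thesis using measure_band[of 1] by simp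
qed

section \<open>Square integrable functions\<close>

text \<open>Squared norms carry the limit arguments below, by way of the pointwise bound
  \<open>\<bar>a + b\<bar>\<^sup>2 \<le> 2\<bar>a\<bar>\<^sup>2 + 2\<bar>b\<bar>\<^sup>2\<close>.\<close>

definition sqnorm :: "(real^3 \<Rightarrow> complex) \<Rightarrow> real" where
  "sqnorm u = (LINT x|S2. (cmod (u x))\<^sup>2)"

lemma sqnorm_nonneg: "0 \<le> sqnorm u"
  by (simp add: sqnorm_def)

lemma L2_norm_eq: "L2_norm u = sqrt (sqnorm u)"
  by (simp add: L2_norm_def sqnorm_def)

lemma sqnorm_cong: "(\<And>x. x \<in> sphere 0 1 \<Longrightarrow> u x = v x) \<Longrightarrow> sqnorm u = sqnorm v"
  unfolding sqnorm_def by (intro Bochner_Integration.integral_cong) auto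

lemma L2_fun_cong:
  assumes "\<And>x. x \<in> sphere 0 1 \<Longrightarrow> u x = v x"
  shows "L2_fun u \<longleftrightarrow> L2_fun v"
proof -
  have "u \<in> borel_measurable S2 \<longleftrightarrow> v \<in> borel_measurable S2"
    by (intro measurable_cong) (simp add: assms)
  moreover have "integrable S2 (\<lambda>x. (cmod (u x))\<^sup>2) \<longleftrightarrow> integrable S2 (\<lambda>x. (cmod (v x))\<^sup>2)"
    by (intro Bochner_Integration.integrable_cong) (simp_all add: assms)
  ultimately show ?thesis by (simp add: L2_fun_def)
qed

lemma L2_fun_measurable: "L2_fun u \<Longrightarrow> u \<in> borel_measurable S2"
  by (simp add: L2_fun_def)

lemma L2_fun_integrable: "L2_fun u \<Longrightarrow> integrable S2 (\<lambda>x. (cmod (u x))\<^sup>2)"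
  by (simp add: L2_fun_def)

lemma cmod_add_sq_le: "(cmod (a + b))\<^sup>2 \<le> 2 * (cmod a)\<^sup>2 + 2 * (cmod b)\<^sup>2"
proof -
  have "(cmod (a + b))\<^sup>2 \<le> (cmod a + cmod b)\<^sup>2"
    by (intro power_mono norm_triangle_ineq) auto
  also have "\<dots> \<le> 2 * (cmod a)\<^sup>2 + 2 * (cmod b)\<^sup>2"
    using sum_squares_bound[of "cmod a" "cmod b"] by (simp add: power2_sum)
  finally show ?thesis .
qed

lemma L2_fun_add:
  assumes "L2_fun u" "L2_fun v"
  shows "L2_fun (\<lambda>x. u x + v x)"
  unfolding L2_fun_def
proof
  note [measurable] = assms[THEN L2_fun_measurable]
  show "(\<lambda>x. u x + v x) \<in> borel_measurable S2" by measurable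
  have "integrable S2 (\<lambda>x. 2 * (cmod (u x))\<^sup>2 + 2 * (cmod (v x))\<^sup>2)"
    using assms by (simp add: L2_fun_integrable)
  then show "integrable S2 (\<lambda>x. (cmod (u x + v x))\<^sup>2)"
    by (rule Bochner_Integration.integrable_bound) (auto intro!: AE_I2 order.trans[OF cmod_add_sq_le])
qed

lemma L2_fun_scale:
  assumes "L2_fun u"
  shows "L2_fun (\<lambda>x. c * u x)"
  using assms borel_measurable_times[of "\<lambda>_. c" S2 u]
  by (simp add: L2_fun_def norm_mult power_mult_distrib)

lemma L2_fun_diff: "L2_fun u \<Longrightarrow> L2_fun v \<Longrightarrow> L2_fun (\<lambda>x. u x - v x)"
  using L2_fun_add[OF _ L2_fun_scale[of v "-1"], of u] by simp

lemma L2_fun_sum: "(\<And>i. i \<in> A \<Longrightarrow> L2_fun (u i)) \<Longrightarrow> L2_fun (\<lambda>x. \<Sum>i\<in>A. u i x)"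
  by (induction A rule: infinite_finite_induct) (simp_all add: L2_fun_add, simp_all add: L2_fun_def)

lemma L2_fun_bounded:
  assumes [measurable]: "u \<in> borel_measurable S2" and b: "\<And>x. x \<in> sphere 0 1 \<Longrightarrow> cmod (u x) \<le> B"
  shows "L2_fun u"
proof -
  have "integrable S2 (\<lambda>x. (cmod (u x))\<^sup>2)"
    by (rule S2.integrable_const_bound[of _ "B\<^sup>2"]) (auto intro!: AE_I2 power_mono b)
  then show ?thesis by (simp add: L2_fun_def)
qed

lemma continuous_imp_L2_fun: "continuous_on (sphere 0 1) u \<Longrightarrow> L2_fun u"
  by (auto simp: L2_fun_def continuous_imp_S2_measurable
      intro!: continuous_imp_S2_integrable continuous_intros)

lemma L2_inner_integrable:
  assumes "L2_fun u" "L2_fun v"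
  shows "integrable S2 (\<lambda>x. u x * cnj (v x))"
proof -
  note [measurable] = assms[THEN L2_fun_measurable]
  have "integrable S2 (\<lambda>x. (cmod (u x))\<^sup>2 + (cmod (v x))\<^sup>2)"
    using assms by (simp add: L2_fun_integrable)
  then show ?thesis
  proof (rule Bochner_Integration.integrable_bound)
    have [measurable]: "(\<lambda>x. cnj (v x)) \<in> borel_measurable S2"
      by (intro measurable_compose[OF L2_fun_measurable[OF assms(2)]]
          borel_measurable_continuous_onI continuous_intros)
    show "(\<lambda>x. u x * cnj (v x)) \<in> borel_measurable S2" by measurable
    show "AE x in S2. norm (u x * cnj (v x)) \<le> norm ((cmod (u x))\<^sup>2 + (cmod (v x))\<^sup>2)"
    proof (rule AE_I2)
      fix x
      show "norm (u x * cnj (v x)) \<le> norm ((cmod (u x))\<^sup>2 + (cmod (v x))\<^sup>2)"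
      proof -
        have "0 \<le> cmod (u x) * cmod (v x)" by simp
        then have "cmod (u x) * cmod (v x) \<le> (cmod (u x))\<^sup>2 + (cmod (v x))\<^sup>2"
          using sum_squares_bound[of "cmod (u x)" "cmod (v x)"] by linarith
        then show ?thesis by (simp add: norm_mult)
      qed
    qed
  qed
qed

lemma L2_inner_cnj: "L2_inner v u = cnj (L2_inner u v)"
  using Bochner_Integration.integral_cnj[of S2 "\<lambda>x. u x * cnj (v x)"]
  by (simp add: L2_inner_def mult.commute)

lemma L2_inner_add_left:
  "L2_fun u \<Longrightarrow> L2_fun v \<Longrightarrow> L2_fun w \<Longrightarrow> L2_inner (\<lambda>x. u x + v x) w = L2_inner u w + L2_inner v w"
  by (simp add: L2_inner_def distrib_right Bochner_Integration.integral_add L2_inner_integrable)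

lemma L2_inner_scale_left: "L2_inner (\<lambda>x. c * u x) w = c * L2_inner u w"
  by (simp add: L2_inner_def mult.assoc)

lemma L2_inner_diff_left:
  "L2_fun u \<Longrightarrow> L2_fun v \<Longrightarrow> L2_fun w \<Longrightarrow> L2_inner (\<lambda>x. u x - v x) w = L2_inner u w - L2_inner v w"
  by (simp add: L2_inner_def left_diff_distrib Bochner_Integration.integral_diff L2_inner_integrable)

lemma L2_inner_sum_left:
  "(\<And>i. i \<in> A \<Longrightarrow> L2_fun (u i)) \<Longrightarrow> L2_fun w \<Longrightarrow> L2_inner (\<lambda>x. \<Sum>i\<in>A. u i x) w = (\<Sum>i\<in>A. L2_inner (u i) w)"
  by (simp add: L2_inner_def sum_distrib_right Bochner_Integration.integral_sum L2_inner_integrable)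

lemma L2_inner_self: "L2_inner u u = of_real (sqnorm u)"
  by (simp add: L2_inner_def sqnorm_def complex_norm_square[symmetric] flip: of_real_power)

lemma sqnorm_scale: "sqnorm (\<lambda>x. c * u x) = (cmod c)\<^sup>2 * sqnorm u"
  by (simp add: sqnorm_def norm_mult power_mult_distrib)

lemma sqnorm_add_le:
  assumes "L2_fun u" "L2_fun v"
  shows "sqnorm (\<lambda>x. u x + v x) \<le> 2 * sqnorm u + 2 * sqnorm v"
proof -
  have "sqnorm (\<lambda>x. u x + v x) \<le> (LINT x|S2. 2 * (cmod (u x))\<^sup>2 + 2 * (cmod (v x))\<^sup>2)"
    unfolding sqnorm_def
    using assms L2_fun_add[OF assms] by (intro integral_mono cmod_add_sq_le) (simp_all add: L2_fun_integrable)
  also have "\<dots> = 2 * sqnorm u + 2 * sqnorm v"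
    using assms by (simp add: sqnorm_def L2_fun_integrable)
  finally show ?thesis .
qed

lemma sqnorm_add_orthogonal:
  assumes "L2_fun u" "L2_fun v" "L2_inner u v = 0"
  shows "sqnorm (\<lambda>x. u x + v x) = sqnorm u + sqnorm v"
proof -
  let ?s = "\<lambda>x. u x + v x"
  have L: "L2_fun ?s" using assms by (simp add: L2_fun_add)
  have 1: "L2_inner u ?s = L2_inner u u" "L2_inner v ?s = L2_inner v v"
    using assms L2_inner_cnj[of u ?s] L2_inner_cnj[of v ?s] L2_inner_cnj[of v u]
    by (simp_all add: L2_inner_add_left L2_inner_self)
  have "of_real (sqnorm ?s) = L2_inner u ?s + L2_inner v ?s"
    using assms L by (simp add: L2_inner_add_left flip: L2_inner_self)
  also have "\<dots> = of_real (sqnorm u + sqnorm v)"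
    by (simp add: 1 L2_inner_self)
  finally show ?thesis by (simp only: of_real_eq_iff)
qed

lemma sqnorm_dominated_convergence:
  assumes u: "u \<in> borel_measurable S2" and v: "\<And>n. v n \<in> borel_measurable S2"
    and w: "integrable S2 w"
    and bound: "\<And>n x. x \<in> sphere 0 1 \<Longrightarrow> (cmod (u x - v n x))\<^sup>2 \<le> w x"
    and lim: "\<And>x. x \<in> sphere 0 1 \<Longrightarrow> (\<lambda>n. v n x) \<longlonglongrightarrow> u x"
  shows "(\<lambda>n. sqnorm (\<lambda>x. u x - v n x)) \<longlonglongrightarrow> 0"
proof -
  note [measurable] = u v
  have "(\<lambda>n. LINT x|S2. (cmod (u x - v n x))\<^sup>2) \<longlonglongrightarrow> (LINT x|S2. 0)"
  proof (rule integral_dominated_convergence[OF _ _ w])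
    show "AE x in S2. (\<lambda>n. (cmod (u x - v n x))\<^sup>2) \<longlonglongrightarrow> 0"
    proof (rule AE_I2)
      fix x assume "x \<in> space S2"
      then have "(\<lambda>n. (cmod (u x - v n x))\<^sup>2) \<longlonglongrightarrow> (cmod (u x - u x))\<^sup>2"
        by (intro tendsto_intros lim) simp
      then show "(\<lambda>n. (cmod (u x - v n x))\<^sup>2) \<longlonglongrightarrow> 0" by simp
    qed
  qed (use bound in auto)
  then show ?thesis by (simp add: sqnorm_def)
qed

text \<open>The property passes from polynomials to continuous functions by Stone--Weierstrass, then to
  indicators of closed sets (as pointwise limits of continuous functions), to indicators of Borel
  sets by Dynkin's lemma, to simple functions by linearity, and to all functions by dominated
  convergence.  This is the density of polynomials in \<open>L\<^sup>2\<close>; as an induction rule it applies directly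
  to the property of being the limit of one's expansion.\<close>

theorem L2_density_induct [consumes 1, case_names poly add scale limit]:
  assumes u: "L2_fun u"
    and poly: "\<And>p. real_polynomial_function p \<Longrightarrow> P (\<lambda>x. of_real (p x))"
    and add: "\<And>u v. P u \<Longrightarrow> P v \<Longrightarrow> P (\<lambda>x. u x + v x)"
    and scale: "\<And>c u. P u \<Longrightarrow> P (\<lambda>x. c * u x)"
    and limit: "\<And>u v. L2_fun u \<Longrightarrow> (\<And>n. P (v n)) \<Longrightarrow>
      (\<lambda>n. sqnorm (\<lambda>x. u x - v n x)) \<longlonglongrightarrow> 0 \<Longrightarrow> P u"
  shows "P u"
proof -
  have cont: "P (\<lambda>x. of_real (g x))" if g: "continuous_on (sphere 0 1) g" for g :: "real^3 \<Rightarrow> real"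
  proof -
    have "\<exists>p. real_polynomial_function p \<and> (\<forall>x\<in>sphere 0 1. \<bar>g x - p x\<bar> < 1 / real (Suc n))" for n
      using Stone_Weierstrass_real_polynomial_function[OF compact_sphere g, of "1 / real (Suc n)"]
      by (metis divide_pos_pos of_nat_0_less_iff zero_less_Suc zero_less_one)
    then obtain p where p: "\<And>n. real_polynomial_function (p n)"
        "\<And>n x. x \<in> sphere 0 1 \<Longrightarrow> \<bar>g x - p n x\<bar> < 1 / real (Suc n)"
      by metis
    have meas: "(\<lambda>x. of_real (p n x) :: complex) \<in> borel_measurable S2" for n
      by (intro continuous_imp_S2_measurable continuous_intros
          continuous_on_polymonial_function p(1)[THEN real_polynomial_function_eq[THEN iffD1]])
    have gL: "L2_fun (\<lambda>x. of_real (g x))"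
      by (intro continuous_imp_L2_fun continuous_intros g)
    show ?thesis
    proof (rule limit[OF gL])
      show "(\<lambda>n. sqnorm (\<lambda>x. of_real (g x) - of_real (p n x))) \<longlonglongrightarrow> 0"
      proof (rule sqnorm_dominated_convergence[OF L2_fun_measurable[OF gL] meas, of "\<lambda>_. 1"])
        fix x :: "real^3" and n assume x: "x \<in> sphere 0 1"
        have "\<bar>g x - p n x\<bar> \<le> 1"
          using p(2)[OF x, of n] by (rule order.trans[OF less_imp_le]) (simp add: field_simps)
        then show "(cmod (of_real (g x) - of_real (p n x)))\<^sup>2 \<le> 1"
          by (metis of_real_diff norm_of_real abs_square_le_1 power2_abs)
        have "(\<lambda>n. p n x) \<longlonglongrightarrow> g x"
        proof (rule LIMSEQ_I)
          fix r :: real assume "0 < r"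
          then obtain N where N: "1 / real (Suc N) < r" using nat_approx_posE by blast
          show "\<exists>N. \<forall>n\<ge>N. norm (p n x - g x) < r"
          proof (intro exI allI impI)
            fix n assume "N \<le> n"
            then have "1 / real (Suc n) \<le> 1 / real (Suc N)" by (simp add: field_simps)
            then show "norm (p n x - g x) < r" using p(2)[OF x, of n] N
              by (simp add: abs_minus_commute)
          qed
        qed
        then show "(\<lambda>n. complex_of_real (p n x)) \<longlonglongrightarrow> complex_of_real (g x)"
          by (rule tendsto_of_real)
      qed simp
    qed (rule poly[OF p(1)])
  qed
  have P0: "P (\<lambda>x. 0)" using cont[of "\<lambda>_. 0"] by simp
  have Psum: "P (\<lambda>x. \<Sum>i\<in>A. v i x)" if "finite A" "\<And>i. i \<in> A \<Longrightarrow> P (v i)" for A :: "'i set" and v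
    using that by (induction A rule: finite_induct) (simp_all add: P0 add)
  have Psum_nat: "P (\<lambda>x. \<Sum>i<n. v i x)" if "\<And>i. P (v i)" for n :: nat and v
    using that by (induction n) (simp_all add: P0 add)
  have ind_meas: "(\<lambda>x. of_real (indicator A x) :: complex) \<in> borel_measurable S2" if A: "A \<in> sets borel" for A
  proof -
    have "(indicator A :: _ \<Rightarrow> real) \<in> borel_measurable (restrict_space borel (sphere 0 1))"
      using A by (intro measurable_restrict_space1 borel_measurable_indicator)
    then show ?thesis unfolding measurable_S2_iff by measurable
  qed
  have indicator: "P (\<lambda>x. of_real (indicator A x))" if A: "A \<in> sets borel" for A
  proof -
    have "Int_stable (Collect closed :: (real^3) set set)" by (auto simp: Int_stable_def)
    moreover have "Collect closed \<subseteq> Pow (UNIV :: (real^3) set)" by simp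
    moreover have "A \<in> sigma_sets UNIV (Collect closed)"
      using A by (simp add: borel_eq_closed)
    ultimately show ?thesis
    proof (induction rule: sigma_sets_induct_disjoint)
      case (basic C)
      show ?case
      proof (cases "C = {}")
        case True
        then show ?thesis using P0 by simp
      next
        case False
        \<comment> \<open>Continuous and equal to 1 on \<open>C\<close>; the slope \<open>n\<close> pushes the values outside \<open>C\<close> down to 0.\<close>
        define g where "g n x = max 0 (1 - real n * infdist x C)" for n and x :: "real^3"
        have gc: "continuous_on S (g n)" for n S
          unfolding g_def by (intro continuous_intros)
        have Cb: "C \<in> sets borel" using basic by auto
        show ?thesis
        proof (rule limit[OF L2_fun_bounded[OF ind_meas[OF Cb], of 1] cont[OF gc]])
          show "(\<lambda>n. sqnorm (\<lambda>x. of_real (indicator C x) - of_real (g n x))) \<longlonglongrightarrow> 0"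
          proof (rule sqnorm_dominated_convergence[OF ind_meas[OF Cb], of _ "\<lambda>_. 1"])
            show "(\<lambda>x. complex_of_real (g n x)) \<in> borel_measurable S2" for n
              by (intro continuous_imp_S2_measurable continuous_intros gc)
            fix n and x :: "real^3"
            have "\<bar>indicator C x - g n x\<bar> \<le> 1"
              using infdist_nonneg[of x C] by (auto simp: g_def indicator_def)
            then show "(cmod (of_real (indicator C x) - of_real (g n x)))\<^sup>2 \<le> 1"
              by (metis of_real_diff norm_of_real abs_square_le_1 power2_abs)
          next
            fix x :: "real^3"
            have "(\<lambda>n. g n x) \<longlonglongrightarrow> indicator C x"
            proof (cases "x \<in> C")
              case True
              then show ?thesis by (simp add: g_def)
            next
              case nC: False
              then have pos: "infdist x C > 0"
                using basic False by (auto simp: infdist_pos_not_in_closed)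
              obtain N where N: "1 < real N * infdist x C"
                using reals_Archimedean3[OF pos] by blast
              have "g n x = 0" if "n \<ge> N" for n
              proof -
                have "real N * infdist x C \<le> real n * infdist x C"
                  using that pos by simp
                then show ?thesis using N by (simp add: g_def)
              qed
              then have "eventually (\<lambda>n. g n x = 0) sequentially"
                by (auto simp: eventually_sequentially)
              then show ?thesis using nC by (simp add: tendsto_eventually)
            qed
            then show "(\<lambda>n. complex_of_real (g n x)) \<longlonglongrightarrow> of_real (indicator C x)"
              by (rule tendsto_of_real)
          qed simp
        qed (auto simp: indicator_def)
      qed
    next
      case empty
      then show ?case using P0 by simp
    next
      case (compl A)
      have "P (\<lambda>x. of_real 1 + (-1) * of_real (indicator A x))"
        by (intro add scale cont compl.IH) auto
      moreover have "of_real 1 + (-1) * of_real (indicator A x) = (of_real (indicator (UNIV - A) x) :: complex)" for x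
        by (simp add: indicator_def)
      ultimately show ?case by simp
    next
      case (union A)
      have Ab: "A i \<in> sets borel" for i using union.hyps(2) by (auto simp: borel_eq_closed)
      then have Ub: "(\<Union>i. A i) \<in> sets borel" by blast
      show ?case
      proof (rule limit[OF L2_fun_bounded[OF ind_meas[OF Ub], of 1] Psum_nat[OF union.IH]])
        show "(\<lambda>n. sqnorm (\<lambda>x. of_real (indicator (\<Union>i. A i) x) - (\<Sum>i<n. of_real (indicator (A i) x)))) \<longlonglongrightarrow> 0"
        proof (rule sqnorm_dominated_convergence[OF ind_meas[OF Ub], of _ "\<lambda>_. 1"])
          show "(\<lambda>x. \<Sum>i<n. complex_of_real (indicator (A i) x)) \<in> borel_measurable S2" for n
            by (intro borel_measurable_sum ind_meas Ab)
          fix n and x :: "real^3"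
          have "(\<Sum>i<n. indicator (A i) x :: real) = indicator (\<Union>i<n. A i) x"
            using union.hyps(1)
            by (subst indicator_UN_disjoint) (auto simp: disjoint_family_on_def)
          then have "(\<Sum>i<n. complex_of_real (indicator (A i) x)) = of_real (indicator (\<Union>i<n. A i) x)"
            by (simp flip: of_real_sum)
          then show "(cmod (of_real (indicator (\<Union>i. A i) x) - (\<Sum>i<n. of_real (indicator (A i) x))))\<^sup>2 \<le> 1"
            by (simp add: indicator_def)
        next
          fix x :: "real^3"
          have "(\<lambda>n. \<Sum>i<n. indicator (A i) x :: real) \<longlonglongrightarrow> indicator (\<Union>i. A i) x"
            using indicator_sums[of A x] union.hyps(1) by (auto simp: sums_def disjoint_family_on_def)
          from tendsto_of_real[OF this]
          show "(\<lambda>n. \<Sum>i<n. complex_of_real (indicator (A i) x)) \<longlonglongrightarrow> of_real (indicator (\<Union>i. A i) x)"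
            by simp
        qed simp
      qed (auto simp: indicator_def)
    qed
  qed
  have um: "u \<in> borel_measurable S2" by (rule L2_fun_measurable[OF u])
  obtain F where F: "\<And>i. simple_function S2 (F i)"
      "\<And>x. x \<in> space S2 \<Longrightarrow> (\<lambda>i. F i x) \<longlonglongrightarrow> u x"
      "\<And>i x. x \<in> space S2 \<Longrightarrow> norm (F i x) \<le> 2 * norm (u x)"
  proof -
    obtain F where "(\<forall>i. simple_function S2 (F i)) \<and>
        (\<forall>x\<in>space S2. (\<lambda>i. F i x) \<longlonglongrightarrow> u x) \<and>
        (\<forall>i. \<forall>x\<in>space S2. dist (F i x) 0 \<le> 2 * dist (u x) 0)"
      by (rule exE[OF borel_measurable_implies_sequence_metric[OF um, of 0]])
    then show ?thesis by (intro that[of F]) (simp_all only: dist_0_norm dist_norm diff_0_right)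
  qed
  define G where "G i x = (\<Sum>y\<in>F i ` space S2. y * of_real (indicator (F i -` {y} \<inter> space S2) x))" for i x
  have G: "G i x = F i x" if "x \<in> space S2" for i x
    using simple_function_indicator_representation_banach[OF F(1) that, of i]
    by (simp only: G_def scaleR_conv_of_real mult.commute)
  have Sb: "F i -` {y} \<inter> space S2 \<in> sets borel" for i y
  proof -
    have "F i -` {y} \<inter> space S2 \<in> sets S2" using F(1) by (rule simple_functionD)
    then show ?thesis
      by (simp add: sets_S2 sets_restrict_space_iff)
  qed
  have PG: "P (G i)" for i
    unfolding G_def using F(1)[of i]
    by (intro Psum scale indicator Sb) (auto simp: simple_function_def)
  have Gm: "G i \<in> borel_measurable S2" for i
    using borel_measurable_simple_function[OF F(1), of i] by (rule measurable_cong[THEN iffD1, rotated]) (simp add: G)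
  show "P u"
  proof (rule limit[OF u PG])
    show "(\<lambda>n. sqnorm (\<lambda>x. u x - G n x)) \<longlonglongrightarrow> 0"
    proof (rule sqnorm_dominated_convergence[OF um Gm, of "\<lambda>x. 9 * (cmod (u x))\<^sup>2"])
      show "integrable S2 (\<lambda>x. 9 * (cmod (u x))\<^sup>2)" using u by (simp add: L2_fun_integrable)
      fix n and x :: "real^3" assume x: "x \<in> sphere 0 1"
      have "cmod (u x - G n x) \<le> 3 * cmod (u x)"
        using norm_triangle_ineq4[of "u x" "G n x"] F(3)[of x n] G[of x n] x by simp
      then have "(cmod (u x - G n x))\<^sup>2 \<le> (3 * cmod (u x))\<^sup>2" by (intro power_mono) auto
      then show "(cmod (u x - G n x))\<^sup>2 \<le> 9 * (cmod (u x))\<^sup>2" by (simp add: power_mult_distrib)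
    next
      fix x :: "real^3" assume "x \<in> sphere 0 1"
      then show "(\<lambda>n. G n x) \<longlonglongrightarrow> u x" using F(2)[of x] G by simp
    qed
  qed
qed

section \<open>Expansions in orthonormal sequences\<close>

locale L2_orthonormal =
  fixes e :: "nat \<Rightarrow> real^3 \<Rightarrow> complex"
  assumes L2: "L2_fun (e j)"
    and orthonormal: "L2_inner (e j) (e k) = (if j = k then 1 else 0)"
begin

definition partial_expansion :: "nat \<Rightarrow> (real^3 \<Rightarrow> complex) \<Rightarrow> real^3 \<Rightarrow> complex" where
  "partial_expansion n u x = (\<Sum>j<n. L2_inner u (e j) * e j x)"

definition expandable :: "(real^3 \<Rightarrow> complex) \<Rightarrow> bool" where
  "expandable u \<longleftrightarrow> L2_fun u \<and> (\<lambda>n. sqnorm (\<lambda>x. u x - partial_expansion n u x)) \<longlonglongrightarrow> 0"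

lemma L2_combination: "L2_fun (\<lambda>x. \<Sum>j<n. a j * e j x)"
  by (intro L2_fun_sum L2_fun_scale L2)

lemma L2_partial_expansion: "L2_fun (partial_expansion n u)"
  unfolding partial_expansion_def by (rule L2_combination)

lemma inner_combination:
  "L2_inner (\<lambda>x. \<Sum>j<n. a j * e j x) (e k) = (if k < n then a k else 0)"
  by (subst L2_inner_sum_left)
    (auto simp: L2_fun_scale L2 L2_inner_scale_left orthonormal if_distrib[of "\<lambda>c. _ * c"] cong: if_cong)

text \<open>The error \<open>u - P u\<close> of the partial expansion is orthogonal to the span of the first \<open>n\<close> elements,
  so Pythagoras compares it with any other approximation from that span.\<close>

lemma best_approximation:
  assumes u: "L2_fun u"
  shows "sqnorm (\<lambda>x. u x - partial_expansion n u x) \<le> sqnorm (\<lambda>x. u x - (\<Sum>j<n. a j * e j x))"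
proof -
  let ?r = "\<lambda>x. u x - partial_expansion n u x"
  let ?d = "\<lambda>x. \<Sum>j<n. (L2_inner u (e j) - a j) * e j x"
  have r: "L2_fun ?r" by (intro L2_fun_diff u L2_partial_expansion)
  have re: "L2_inner ?r (e k) = 0" if "k < n" for k
    using that inner_combination[of "\<lambda>j. L2_inner u (e j)" n k]
    by (simp add: L2_inner_diff_left u L2_partial_expansion L2 flip: partial_expansion_def)
  have "L2_inner ?d ?r = (\<Sum>j<n. (L2_inner u (e j) - a j) * L2_inner (e j) ?r)"
    by (subst L2_inner_sum_left) (simp_all add: L2_fun_scale L2 r L2_inner_scale_left)
  also have "\<dots> = 0"
    using re by (intro sum.neutral) (simp add: L2_inner_cnj[of "e _"])
  finally have "L2_inner ?r ?d = 0" by (simp add: L2_inner_cnj[of ?r])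
  from sqnorm_add_orthogonal[OF r L2_combination this]
  have "sqnorm (\<lambda>x. ?r x + ?d x) = sqnorm ?r + sqnorm ?d" .
  moreover have "(\<lambda>x. ?r x + ?d x) = (\<lambda>x. u x - (\<Sum>j<n. a j * e j x))"
    by (simp add: partial_expansion_def left_diff_distrib sum_subtractf)
  ultimately show ?thesis using sqnorm_nonneg[of ?d] by simp
qed

text \<open>If \<open>v\<close> is close to \<open>u\<close>, then by best approximation the error of \<open>u\<close> is at most that of using the
  partial expansion of \<open>v\<close> for \<open>u\<close>, which is controlled by \<open>\<bar>u - v\<bar>\<close> and the error of \<open>v\<close>.\<close>

lemma expandable_limit:
  assumes u: "L2_fun u" and v: "\<And>n. expandable (v n)"
    and lim: "(\<lambda>n. sqnorm (\<lambda>x. u x - v n x)) \<longlonglongrightarrow> 0"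
  shows "expandable u"
  unfolding expandable_def
proof (intro conjI u LIMSEQ_I)
  fix r :: real assume r: "0 < r"
  obtain m where m: "sqnorm (\<lambda>x. u x - v m x) < r / 4"
    using LIMSEQ_D[OF lim, of "r / 4"] r sqnorm_nonneg by (auto simp: abs_of_nonneg)
  have vm: "L2_fun (v m)" "(\<lambda>n. sqnorm (\<lambda>x. v m x - partial_expansion n (v m) x)) \<longlonglongrightarrow> 0"
    using v[of m] by (simp_all add: expandable_def)
  obtain N where N: "\<And>n. n \<ge> N \<Longrightarrow> sqnorm (\<lambda>x. v m x - partial_expansion n (v m) x) < r / 4"
    using LIMSEQ_D[OF vm(2), of "r / 4"] r sqnorm_nonneg by (auto simp: abs_of_nonneg)
  show "\<exists>N. \<forall>n\<ge>N. norm (sqnorm (\<lambda>x. u x - partial_expansion n u x) - 0) < r"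
  proof (intro exI allI impI)
    fix n assume n: "n \<ge> N"
    have "sqnorm (\<lambda>x. u x - partial_expansion n u x) \<le> sqnorm (\<lambda>x. u x - partial_expansion n (v m) x)"
      unfolding partial_expansion_def[of n "v m"] by (rule best_approximation[OF u])
    also have "\<dots> = sqnorm (\<lambda>x. (u x - v m x) + (v m x - partial_expansion n (v m) x))"
      by simp
    also have "\<dots> \<le> 2 * sqnorm (\<lambda>x. u x - v m x) + 2 * sqnorm (\<lambda>x. v m x - partial_expansion n (v m) x)"
      by (intro sqnorm_add_le L2_fun_diff u vm L2_partial_expansion)
    also have "\<dots> < r" using m N[OF n] by simp
    finally show "norm (sqnorm (\<lambda>x. u x - partial_expansion n u x) - 0) < r"
      using sqnorm_nonneg by simp
  qed
qed

lemma expandable_cong: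
  assumes "expandable u" "L2_fun v" "\<And>x. x \<in> sphere 0 1 \<Longrightarrow> v x = u x"
  shows "expandable v"
proof (rule expandable_limit[OF assms(2), of "\<lambda>_. u"])
  have "sqnorm (\<lambda>x. v x - u x) = sqnorm (\<lambda>_. 0)"
    using assms(3) by (intro sqnorm_cong) simp
  then show "(\<lambda>n. sqnorm (\<lambda>x. v x - u x)) \<longlonglongrightarrow> 0" by (simp add: sqnorm_def)
qed (rule assms(1))

lemma expandable_scale:
  assumes "expandable u"
  shows "expandable (\<lambda>x. c * u x)"
proof -
  have "sqnorm (\<lambda>x. c * u x - partial_expansion n (\<lambda>x. c * u x) x) =
      (cmod c)\<^sup>2 * sqnorm (\<lambda>x. u x - partial_expansion n u x)" for n
    unfolding sqnorm_scale[symmetric] partial_expansion_def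
    by (simp add: L2_inner_scale_left sum_distrib_left algebra_simps)
  then show ?thesis
    using assms by (simp add: expandable_def L2_fun_scale tendsto_mult_right_zero)
qed

lemma expandable_add:
  assumes u: "expandable u" and v: "expandable v"
  shows "expandable (\<lambda>x. u x + v x)"
proof -
  let ?R = "\<lambda>n u x. u x - partial_expansion n u x"
  have L: "L2_fun u" "L2_fun v" using assms by (simp_all add: expandable_def)
  have eq: "?R n (\<lambda>x. u x + v x) = (\<lambda>x. ?R n u x + ?R n v x)" for n
    by (simp add: partial_expansion_def L2_inner_add_left L L2 distrib_right sum.distrib fun_eq_iff)
  have "(\<lambda>n. sqnorm (?R n (\<lambda>x. u x + v x))) \<longlonglongrightarrow> 0"
  proof (rule tendsto_sandwich[of "\<lambda>_. 0"])
    show "(\<lambda>n. 2 * sqnorm (?R n u) + 2 * sqnorm (?R n v)) \<longlonglongrightarrow> 0"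
      using assms by (auto simp: expandable_def intro!: tendsto_eq_intros)
    show "\<forall>\<^sub>F n in sequentially. sqnorm (?R n (\<lambda>x. u x + v x)) \<le> 2 * sqnorm (?R n u) + 2 * sqnorm (?R n v)"
      unfolding eq by (intro always_eventually allI sqnorm_add_le L2_fun_diff L L2_partial_expansion)
  qed (auto simp: sqnorm_nonneg)
  then show ?thesis using L by (simp add: expandable_def L2_fun_add)
qed

lemma expandable_basis: "expandable (e k)"
proof -
  have "partial_expansion n (e k) = e k" if "k < n" for n
    using that by (simp add: partial_expansion_def orthonormal fun_eq_iff if_distrib[of "\<lambda>c. c * _"] cong: if_cong)
  then have "\<forall>\<^sub>F n in sequentially. sqnorm (\<lambda>x. e k x - partial_expansion n (e k) x) = 0"
    by (auto simp: eventually_sequentially sqnorm_def intro!: exI[of _ "Suc k"])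
  then show ?thesis by (simp add: expandable_def L2 tendsto_eventually)
qed

text \<open>The expandable functions satisfy the closure conditions of the density rule, so completeness of
  an orthonormal sequence needs to be tested on polynomials only.\<close>

lemma orthonormal_basisI:
  assumes "\<And>p. real_polynomial_function p \<Longrightarrow> expandable (\<lambda>x. of_real (p x))"
  shows "orthonormal_basis e"
  unfolding orthonormal_basis_def
proof (intro conjI allI impI L2 orthonormal)
  fix u assume "L2_fun u"
  from L2_density_induct[OF this assms expandable_add expandable_scale expandable_limit]
  have "expandable u" .
  then show "(\<lambda>n. L2_norm (\<lambda>x. u x - (\<Sum>j<n. L2_inner u (e j) * e j x))) \<longlonglongrightarrow> 0"
    unfolding L2_norm_eq using tendsto_real_sqrt[of _ 0]
    by (auto simp: expandable_def partial_expansion_def)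
qed

end

section \<open>Ultraspherical polynomials\<close>

text \<open>Up to a constant factor this is the \<open>M\<close>-th derivative of the Legendre polynomial of degree
  \<open>M + k\<close>, by Rodrigues' formula.  Indexing by the degree \<open>k\<close> rather than by \<open>M + k\<close> makes the index
  set of the spherical harmonics the full product \<open>\<int> \<times> \<nat>\<close>.\<close>

definition ultraspherical :: "nat \<Rightarrow> nat \<Rightarrow> real poly" where
  "ultraspherical M k = (pderiv ^^ (2 * M + k)) ([:1, 0, -1:] ^ (M + k))"

text \<open>The power \<open>w = (1 - t\<^sup>2)\<^sup>l\<close> solves the first-order equation \<open>(1 - t\<^sup>2) w' + 2 l t w = 0\<close>.
  Differentiating it once gives the case \<open>j = 0\<close>, and each further derivative reproduces the
  equation with \<open>j - l\<close> raised by one.  Letting the order \<open>j - l\<close> start at the negative value \<open>-l\<close>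
  thus gives Legendre's equation and all its derivatives in a single induction.\<close>

lemma iterated_pderiv_ode:
  fixes l j :: nat
  defines "w \<equiv> \<lambda>j. (pderiv ^^ j) ([:1, 0, -1 :: real:] ^ l)"
  shows "[:1, 0, -1:] * w (Suc (Suc j)) - smult (2 * (real j - real l + 1)) ([:0, 1:] * w (Suc j))
    + smult (real l * (real l + 1) - (real j - real l) * (real j - real l + 1)) (w j) = 0"
proof -
  have w_Suc: "pderiv (w j) = w (Suc j)" for j by (simp add: w_def)
  note eval = pderiv_add pderiv_minus pderiv_diff pderiv_mult pderiv_smult pderiv_pCons w_Suc
  show ?thesis
  proof (induction j)
    case 0
    have first_order: "[:1, 0, -1:] * w 1 + smult (2 * real l) ([:0, 1:] * w 0) = 0"
    proof (cases l)
      case 0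
      then show ?thesis by (simp add: w_def)
    next
      case (Suc n)
      have w1: "w 1 = smult (real (Suc n)) ([:1, 0, -1:] ^ n) * [:0, -2:]"
        by (simp add: w_def Suc pderiv_power_Suc pderiv_pCons del: power_Suc)
      show ?thesis
        unfolding w1
        by (rule poly_eq_poly_eq_iff[THEN iffD1, OF ext]) (simp add: w_def Suc algebra_simps)
    qed
    have d: "pderiv ([:1, 0, -1:] * w 1 + smult (2 * real l) ([:0, 1:] * w 0)) = 0"
      unfolding first_order by simp
    show ?case
    proof (rule poly_eq_poly_eq_iff[THEN iffD1, OF ext])
      fix t
      from d have "poly (pderiv ([:1, 0, -1:] * w 1 + smult (2 * real l) ([:0, 1:] * w 0))) t = 0" by simp
      then show "poly ([:1, 0, -1:] * w (Suc (Suc 0)) - smult (2 * (real 0 - real l + 1)) ([:0, 1:] * w (Suc 0))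
          + smult (real l * (real l + 1) - (real 0 - real l) * (real 0 - real l + 1)) (w 0)) t = poly 0 t"
        by (simp add: eval algebra_simps)
    qed
  next
    case (Suc j)
    show ?case
    proof (rule poly_eq_poly_eq_iff[THEN iffD1, OF ext])
      fix t
      have "poly (pderiv ([:1, 0, -1:] * w (Suc (Suc j)) - smult (2 * (real j - real l + 1)) ([:0, 1:] * w (Suc j))
        + smult (real l * (real l + 1) - (real j - real l) * (real j - real l + 1)) (w j))) t = 0"
        unfolding Suc.IH by simp
      then show "poly ([:1, 0, -1:] * w (Suc (Suc (Suc j)))
          - smult (2 * (real (Suc j) - real l + 1)) ([:0, 1:] * w (Suc (Suc j)))
          + smult (real l * (real l + 1) - (real (Suc j) - real l) * (real (Suc j) - real l + 1)) (w (Suc j))) t = poly 0 t"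
        by (simp add: eval algebra_simps)
    qed
  qed
qed

lemma ultraspherical_ode:
  "(1 - t\<^sup>2) * poly (pderiv (pderiv (ultraspherical M k))) t
     - 2 * (real M + 1) * t * poly (pderiv (ultraspherical M k)) t
     + (real (M + k) * (real (M + k) + 1) - real M * (real M + 1)) * poly (ultraspherical M k) t = 0"
proof -
  note ode = iterated_pderiv_ode[of "2 * M + k" "M + k"]
  have "poly ([:1, 0, -1:] * pderiv (pderiv (ultraspherical M k))
      - smult (2 * (real M + 1)) ([:0, 1:] * pderiv (ultraspherical M k))
      + smult (real (M + k) * (real (M + k) + 1) - real M * (real M + 1)) (ultraspherical M k)) t = 0"
    using ode by (simp add: ultraspherical_def)
  then show ?thesis by (simp add: power2_eq_square algebra_simps)
qed

lemma iterated_pderiv_degree: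
  fixes p :: "real poly"
  assumes "p \<noteq> 0" "n \<le> degree p"
  shows "(pderiv ^^ n) p \<noteq> 0 \<and> degree ((pderiv ^^ n) p) = degree p - n"
  using assms by (induction n) (auto simp: pderiv_eq_0_iff degree_pderiv)

lemma degree_ultraspherical: "degree (ultraspherical M k) = k"
  and ultraspherical_nonzero: "ultraspherical M k \<noteq> 0"
proof -
  have "degree ([:1, 0, -1 :: real:] ^ (M + k)) = 2 * (M + k)"
    by (simp add: degree_power_eq)
  then show "degree (ultraspherical M k) = k" "ultraspherical M k \<noteq> 0"
    using iterated_pderiv_degree[of "[:1, 0, -1:] ^ (M + k)" "2 * M + k"]
    by (auto simp: ultraspherical_def)
qed

text \<open>This is the symmetry of the Sturm--Liouville operator: multiplied by the difference of the
  eigenvalues, the weighted product of two solutions is the derivative of the weighted Wronskian,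
  which vanishes at \<open>t = 1\<close> and \<open>t = -1\<close>.  Orthogonality follows by integration.\<close>

lemma ultraspherical_wronskian:
  fixes M k n :: nat
  defines "p \<equiv> ultraspherical M" and "lam \<equiv> \<lambda>k. real (M + k) * (real (M + k) + 1)"
  shows "poly (pderiv ([:1, 0, -1:] ^ Suc M * (p k * pderiv (p n) - pderiv (p k) * p n))) t
    = (lam k - lam n) * ((1 - t\<^sup>2) ^ M * poly (p k) t * poly (p n) t)"
proof -
  define S where "S = (1 - t\<^sup>2) ^ M"
  have Q: "poly [:1, 0, -1:] t = 1 - t\<^sup>2" by (simp add: power2_eq_square)
  have k: "(1 - t\<^sup>2) * poly (pderiv (pderiv (p k))) t =
      2 * (real M + 1) * t * poly (pderiv (p k)) t - (lam k - real M * (real M + 1)) * poly (p k) t"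
    using ultraspherical_ode[of t M k] by (simp add: p_def lam_def)
  have n: "(1 - t\<^sup>2) * poly (pderiv (pderiv (p n))) t =
      2 * (real M + 1) * t * poly (pderiv (p n)) t - (lam n - real M * (real M + 1)) * poly (p n) t"
    using ultraspherical_ode[of t M n] by (simp add: p_def lam_def)
  have "poly (pderiv ([:1, 0, -1:] ^ Suc M * (p k * pderiv (p n) - pderiv (p k) * p n))) t =
      S * (poly (p k) t * ((1 - t\<^sup>2) * poly (pderiv (pderiv (p n))) t)
         - ((1 - t\<^sup>2) * poly (pderiv (pderiv (p k))) t) * poly (p n) t)
      - S * (2 * (real M + 1) * t) * (poly (p k) t * poly (pderiv (p n)) t - poly (pderiv (p k)) t * poly (p n) t)"
    unfolding pderiv_mult pderiv_power_Suc pderiv_diff poly_mult poly_add poly_diff poly_smult poly_power Q S_def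
    by (simp add: pderiv_pCons algebra_simps)
  also have "\<dots> = (lam k - lam n) * (S * poly (p k) t * poly (p n) t)"
    unfolding k n by (simp add: algebra_simps)
  finally show ?thesis by (simp add: S_def)
qed

section \<open>Spherical harmonics\<close>

text \<open>The function \<open>e\<^sup>i\<^sup>m\<^sup>\<phi> sin\<^sup>\<bar>\<^sup>m\<^sup>\<bar> \<theta>\<close> as a polynomial in Cartesian coordinates.\<close>

definition zeta :: "int \<Rightarrow> real^3 \<Rightarrow> complex" where
  "zeta m x = (if 0 \<le> m then Complex (x $ 1) (x $ 2) ^ nat m else Complex (x $ 1) (- (x $ 2)) ^ nat (- m))"

lemma zeta_sph: "zeta m (sph \<theta> \<phi>) = of_real (sin \<theta> ^ nat \<bar>m\<bar>) * cis (of_int m * \<phi>)"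
proof -
  have "Complex (sin \<theta> * cos \<phi>) (sin \<theta> * sin \<phi>) = of_real (sin \<theta>) * cis \<phi>"
    "Complex (sin \<theta> * cos \<phi>) (- (sin \<theta> * sin \<phi>)) = of_real (sin \<theta>) * cis (- \<phi>)"
    by (simp_all add: complex_eq_iff)
  then show ?thesis by (simp add: zeta_def power_mult_distrib Complex.DeMoivre)
qed

lemma cmod_zeta:
  assumes "x \<in> sphere 0 1"
  shows "(cmod (zeta m x))\<^sup>2 = (1 - (x $ 3)\<^sup>2) ^ nat \<bar>m\<bar>"
proof -
  obtain \<theta> \<phi> where x: "x = sph \<theta> \<phi>" using sphere_cases[OF assms] .
  have "(cmod (zeta m x))\<^sup>2 = (\<bar>sin \<theta>\<bar>\<^sup>2) ^ nat \<bar>m\<bar>"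
    by (simp add: x zeta_sph norm_mult norm_power power_mult[symmetric] mult.commute power_even_abs)
  then show ?thesis by (simp add: x sin_squared_eq)
qed

definition harmonic :: "int \<Rightarrow> nat \<Rightarrow> real^3 \<Rightarrow> complex" where
  "harmonic m k x = zeta m x * of_real (poly (ultraspherical (nat \<bar>m\<bar>) k) (x $ 3))"

text \<open>Smoothness asks for directional derivatives of all orders.  A class of functions that is closed
  under taking directional derivatives makes this an induction on the order alone; the inductive
  description of complex polynomials provides such a class.\<close>

inductive polynomial_map :: "(real^3 \<Rightarrow> complex) \<Rightarrow> bool" where
  const: "polynomial_map (\<lambda>x. c)"
| coord: "polynomial_map (\<lambda>x. of_real (x $ i))"
| add: "polynomial_map u \<Longrightarrow> polynomial_map v \<Longrightarrow> polynomial_map (\<lambda>x. u x + v x)"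
| mult: "polynomial_map u \<Longrightarrow> polynomial_map v \<Longrightarrow> polynomial_map (\<lambda>x. u x * v x)"

lemma polynomial_map_power: "polynomial_map u \<Longrightarrow> polynomial_map (\<lambda>x. u x ^ n)"
  by (induction n) (auto intro: polynomial_map.intros)

lemma polynomial_map_poly: "polynomial_map (\<lambda>x. of_real (poly p (x $ i)))"
proof (induction p)
  case 0
  show ?case by (simp add: polynomial_map.const)
next
  case (pCons a p)
  show ?case
    unfolding poly_pCons of_real_add of_real_mult
    by (intro polynomial_map.intros pCons.IH)
qed

lemma polynomial_map_zeta: "polynomial_map (zeta m)"
proof -
  have eq: "Complex a b = of_real a + \<i> * of_real b" for a b by (simp add: complex_eq_iff)
  have "polynomial_map (\<lambda>x. of_real (x $ 1) + (\<i> * s) * of_real (x $ 2))" for s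
    by (intro polynomial_map.intros)
  from this[of 1] this[of "-1"] show ?thesis
    unfolding zeta_def eq by (cases "0 \<le> m") (auto intro: polynomial_map_power)
qed

lemma polynomial_map_harmonic: "polynomial_map (\<lambda>x. c * harmonic m k x)"
  unfolding harmonic_def
  by (intro polynomial_map.mult polynomial_map.const polynomial_map_zeta polynomial_map_poly)

lemma polynomial_map_derivative:
  assumes "polynomial_map u"
  shows "\<exists>D. (\<forall>x. (u has_derivative D x) (at x)) \<and> (\<forall>v. polynomial_map (\<lambda>x. D x v))"
  using assms
proof induction
  case (const c)
  then show ?case by (intro exI[of _ "\<lambda>x v. 0"]) (auto intro: polynomial_map.const)
next
  case (coord i)
  have "bounded_linear (\<lambda>x :: real^3. complex_of_real (x $ i))"
    by (intro bounded_linear_compose[OF bounded_linear_of_real bounded_linear_vec_nth])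
  then show ?case
    by (intro exI[of _ "\<lambda>x v. of_real (v $ i)"])
      (auto intro: polynomial_map.const bounded_linear_imp_has_derivative)
next
  case (add u v)
  then obtain D E where "\<And>x. (u has_derivative D x) (at x)" "\<And>h. polynomial_map (\<lambda>x. D x h)"
      "\<And>x. (v has_derivative E x) (at x)" "\<And>h. polynomial_map (\<lambda>x. E x h)" by blast
  then show ?case
    by (intro exI[of _ "\<lambda>x h. D x h + E x h"]) (auto intro!: has_derivative_add polynomial_map.add)
next
  case (mult u v)
  then obtain D E where "\<And>x. (u has_derivative D x) (at x)" "\<And>h. polynomial_map (\<lambda>x. D x h)"
      "\<And>x. (v has_derivative E x) (at x)" "\<And>h. polynomial_map (\<lambda>x. E x h)" by blast
  with mult.hyps show ?case
    by (intro exI[of _ "\<lambda>x h. u x * E x h + D x h * v x"])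
      (auto intro!: has_derivative_mult polynomial_map.add polynomial_map.mult)
qed

lemma polynomial_map_continuous: "polynomial_map u \<Longrightarrow> continuous_on S u"
  using polynomial_map_derivative
  by (metis continuous_at_imp_continuous_on has_derivative_continuous)

lemma polynomial_map_C_k_on: "polynomial_map u \<Longrightarrow> C_k_on k UNIV u"
proof (induction k arbitrary: u)
  case 0
  then show ?case by (simp add: polynomial_map_continuous)
next
  case (Suc k)
  obtain D where D: "\<And>x. (u has_derivative D x) (at x)" "\<And>v. polynomial_map (\<lambda>x. D x v)"
    using polynomial_map_derivative[OF Suc.prems] by blast
  have "frechet_derivative u (at x) = D x" for x
    using frechet_derivative_at[OF D(1)] by simp
  then show ?case
    using D Suc.IH by (auto simp: differentiable_on_def differentiable_def)
qed

lemma polynomial_map_smooth: "polynomial_map u \<Longrightarrow> smooth_on_sphere u"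
  unfolding smooth_on_sphere_def
  by (intro exI[of _ UNIV] exI[of _ u]) (auto intro: polynomial_map_C_k_on)

text \<open>Separation of variables: the azimuthal factor contributes \<open>-m\<^sup>2 / sin\<^sup>2 \<theta>\<close>, and after the factor
  \<open>sin\<^sup>M \<theta>\<close> is split off, the polar part becomes the ultraspherical equation in \<open>cos \<theta>\<close>.\<close>

lemma harmonic_eigenfunction:
  fixes m :: int and k :: nat
  defines "l \<equiv> real (nat \<bar>m\<bar> + k)"
  shows "laplace_eigenfunction (sqrt (l * (l + 1))) (\<lambda>x. c * harmonic m k x)"
  unfolding laplace_eigenfunction_def
proof (intro conjI ballI allI)
  show "smooth_on_sphere (\<lambda>x. c * harmonic m k x)"
    by (intro polynomial_map_smooth polynomial_map_harmonic)
next
  fix \<theta> \<phi> :: real assume \<theta>: "\<theta> \<in> {0<..<pi}"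
  define M where "M = nat \<bar>m\<bar>"
  define p where "p = ultraspherical M k"
  \<comment> \<open>\<open>G\<close> is the polar factor, \<open>G1 = G'\<close>, \<open>H = sin \<cdot> G'\<close> and \<open>H1 = H'\<close>.  In \<open>H\<close> the factor \<open>sin\<close> has absorbed
    the exponent \<open>M - 1\<close>, which is truncated for \<open>M = 0\<close>.\<close>
  define G where "G t = sin t ^ M * poly p (cos t)" for t :: real
  define G1 where "G1 t = real M * sin t ^ (M - 1) * cos t * poly p (cos t) - sin t ^ Suc M * poly (pderiv p) (cos t)" for t :: real
  define H where "H t = real M * sin t ^ M * cos t * poly p (cos t) - sin t ^ (M + 2) * poly (pderiv p) (cos t)" for t :: real
  define H1 where "H1 t = real M * (real M * sin t ^ (M - 1) * cos t * cos t * poly p (cos t)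
      - sin t ^ Suc M * poly p (cos t) - sin t ^ Suc M * cos t * poly (pderiv p) (cos t))
      - (real (M + 2) * sin t ^ Suc M * cos t * poly (pderiv p) (cos t) - sin t ^ (M + 3) * poly (pderiv (pderiv p)) (cos t))" for t :: real
  define A where "A s = c * cis (of_int m * s)" for s :: real
  have u: "c * harmonic m k (sph t s) = A s * of_real (G t)" for t s
    by (simp add: harmonic_def zeta_sph A_def G_def M_def p_def)

  have "(G has_real_derivative G1 t) (at t)" for t
    unfolding G_def G1_def by (auto intro!: derivative_eq_intros simp: algebra_simps)
  then have dG: "((\<lambda>s. A \<phi> * of_real (G s)) has_vector_derivative A \<phi> * of_real (G1 t)) (at t)" for t
    by (intro has_vector_derivative_mult_right has_vector_derivative_of_real)
      (simp add: has_real_derivative_iff_has_vector_derivative)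
  have HG: "sin t * G1 t = H t" for t
    by (cases M) (simp_all add: H_def G1_def algebra_simps)
  have "(H has_real_derivative H1 \<theta>) (at \<theta>)"
    unfolding H_def H1_def
    by (rule derivative_eq_intros refl)+ (simp add: algebra_simps power3_eq_cube power_add)
  then have dH: "((\<lambda>s. A \<phi> * of_real (H s)) has_vector_derivative A \<phi> * of_real (H1 \<theta>)) (at \<theta>)"
    by (intro has_vector_derivative_mult_right has_vector_derivative_of_real)
      (simp add: has_real_derivative_iff_has_vector_derivative)
  have polar: "vector_derivative (\<lambda>t. sin t *\<^sub>R vector_derivative (\<lambda>s. c * harmonic m k (sph s \<phi>)) (at t)) (at \<theta>)
      = A \<phi> * of_real (H1 \<theta>)"
  proof -
    have "sin t *\<^sub>R vector_derivative (\<lambda>s. c * harmonic m k (sph s \<phi>)) (at t) = A \<phi> * of_real (H t)" for t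
      unfolding u vector_derivative_at[OF dG]
      by (simp add: HG[symmetric] scaleR_conv_of_real)
    then show ?thesis using vector_derivative_at[OF dH] by simp
  qed
  have dA: "(A has_vector_derivative (\<i> * of_int m) * A s) (at s)" for s
  proof -
    have "((\<lambda>s. exp (\<i> * of_real (of_int m * s))) has_vector_derivative (\<i> * of_int m) * exp (\<i> * of_real (of_int m * s))) (at s)"
      by (auto intro!: derivative_eq_intros has_vector_derivative_real_field simp: mult_ac)
    then have "((\<lambda>s. c * exp (\<i> * of_real (of_int m * s))) has_vector_derivative
        c * ((\<i> * of_int m) * exp (\<i> * of_real (of_int m * s)))) (at s)"
      by (rule has_vector_derivative_mult_right)
    then show ?thesis by (simp add: A_def[abs_def] cis_conv_exp mult_ac)
  qed
  have azimuthal: "vector_derivative (\<lambda>t. vector_derivative (\<lambda>s. c * harmonic m k (sph \<theta> s)) (at t)) (at \<phi>)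
      = - (of_int m)\<^sup>2 * (A \<phi> * of_real (G \<theta>))"
  proof -
    have 1: "vector_derivative (\<lambda>s. c * harmonic m k (sph \<theta> s)) (at t) = (\<i> * of_int m) * A t * of_real (G \<theta>)" for t
      unfolding u by (intro vector_derivative_at has_vector_derivative_mult_left dA)
    have 2: "((\<lambda>t. (\<i> * of_int m) * A t * of_real (G \<theta>)) has_vector_derivative
        (\<i> * of_int m) * ((\<i> * of_int m) * A \<phi>) * of_real (G \<theta>)) (at \<phi>)"
      by (intro has_vector_derivative_mult_left has_vector_derivative_mult_right dA)
    show ?thesis unfolding 1 vector_derivative_at[OF 2]
      by (simp add: power2_eq_square algebra_simps)
  qed
  have s0: "sin \<theta> \<noteq> 0" using \<theta> sin_gt_zero[of \<theta>] by auto
  have key: "sin \<theta> * H1 \<theta> - (real M)\<^sup>2 * G \<theta> = - (l * (l + 1)) * (sin \<theta>)\<^sup>2 * G \<theta>"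
  proof -
    define S where "S = sin \<theta> ^ M"
    define c2 where "c2 = cos \<theta>"
    have sq: "(sin \<theta>)\<^sup>2 = 1 - c2\<^sup>2" by (simp add: c2_def sin_squared_eq)
    have ode: "(1 - c2\<^sup>2) * poly (pderiv (pderiv p)) c2 =
        2 * (real M + 1) * c2 * poly (pderiv p) c2 - (l * (l + 1) - real M * (real M + 1)) * poly p c2"
      using ultraspherical_ode[of c2 M k] by (simp add: p_def l_def M_def)
    have "sin \<theta> * H1 \<theta> = real M * (real M * S * c2\<^sup>2 * poly p c2 - S * (sin \<theta>)\<^sup>2 * poly p c2
        - S * (sin \<theta>)\<^sup>2 * c2 * poly (pderiv p) c2)
        - (real (M + 2) * S * (sin \<theta>)\<^sup>2 * c2 * poly (pderiv p) c2 - S * (sin \<theta>)\<^sup>2 * ((sin \<theta>)\<^sup>2 * poly (pderiv (pderiv p)) c2))"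
      unfolding H1_def S_def c2_def
      by (cases M) (simp_all add: algebra_simps power2_eq_square power3_eq_cube power4_eq_xxxx power_add)
    then show ?thesis
      unfolding sq ode G_def S_def[symmetric] c2_def[symmetric]
      by (simp add: algebra_simps power2_eq_square)
  qed
  have m2: "(of_int m :: complex)\<^sup>2 = of_real ((real M)\<^sup>2)"
    by (simp add: M_def flip: of_int_power)
  have "- sphere_laplacian (\<lambda>x. c * harmonic m k x) \<theta> \<phi>
      = - (A \<phi> * of_real ((sin \<theta> * H1 \<theta> - (real M)\<^sup>2 * G \<theta>) / (sin \<theta>)\<^sup>2))"
    unfolding sphere_laplacian_def polar azimuthal m2
    using s0 by (simp add: scaleR_conv_of_real field_simps power2_eq_square)
  also have "\<dots> = of_real ((sqrt (l * (l + 1)))\<^sup>2) * (c * harmonic m k (sph \<theta> \<phi>))"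
    unfolding key u using s0 by (simp add: l_def)
  finally show "- sphere_laplacian (\<lambda>x. c * harmonic m k x) \<theta> \<phi> =
      of_real ((sqrt (l * (l + 1)))\<^sup>2) * (c * harmonic m k (sph \<theta> \<phi>))" .
qed

lemma integral_cis_period:
  assumes "n \<noteq> 0"
  shows "(LINT \<phi>:{0..2 * pi}|lborel. cis (of_int n * \<phi>)) = 0"
proof -
  have d: "((\<lambda>s. exp (\<i> * of_real (of_int n * s)) / (\<i> * of_int n)) has_vector_derivative exp (\<i> * of_real (of_int n * s))) (at s within S)" for s S
    using assms by (auto intro!: derivative_eq_intros has_vector_derivative_real_field simp: field_simps)
  have "(LINT \<phi>|lborel. indicator {0..2 * pi} \<phi> *\<^sub>R exp (\<i> * of_real (of_int n * \<phi>))) =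
      exp (\<i> * of_real (of_int n * (2 * pi))) / (\<i> * of_int n) - exp (\<i> * of_real (of_int n * 0)) / (\<i> * of_int n)"
    by (intro integral_FTC_Icc d continuous_intros) simp
  moreover have "exp (\<i> * of_real (of_int n * (2 * pi))) = 1"
    using cis_multiple_2pi[of "of_int n"] by (simp add: cis_conv_exp mult_ac)
  ultimately show ?thesis by (simp add: set_lebesgue_integral_def cis_conv_exp)
qed

lemma continuous_on_harmonic: "continuous_on S (harmonic m k)"
  using polynomial_map_continuous[OF polynomial_map_harmonic[of 1 m k]] by simp

lemma L2_fun_harmonic: "L2_fun (harmonic m k)"
  by (intro continuous_imp_L2_fun continuous_on_harmonic)

text \<open>For different orders \<open>m\<close> the azimuthal integral vanishes; for equal orders the product depends on
  the height only and is, up to a nonzero factor, the derivative of a weighted Wronskian that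
  vanishes at the poles.\<close>

lemma harmonic_orthogonal:
  assumes "(m, k) \<noteq> (m', k')"
  shows "L2_inner (harmonic m k) (harmonic m' k') = 0"
proof (cases "m = m'")
  case False
  have "integrable S2 (\<lambda>x. harmonic m k x * cnj (harmonic m' k' x))"
    by (intro continuous_imp_S2_integrable continuous_intros continuous_on_harmonic)
  moreover define A where "A \<theta> = complex_of_real (sin \<theta> ^ nat \<bar>m\<bar> * poly (ultraspherical (nat \<bar>m\<bar>) k) (cos \<theta>) *
        (sin \<theta> ^ nat \<bar>m'\<bar> * poly (ultraspherical (nat \<bar>m'\<bar>) k') (cos \<theta>)))" for \<theta>
  moreover have "harmonic m k (sph \<theta> \<phi>) * cnj (harmonic m' k' (sph \<theta> \<phi>)) = A \<theta> * cis (of_int (m - m') * \<phi>)" for \<theta> \<phi>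
  proof -
    have "cis (of_int m * \<phi>) * cnj (cis (of_int m' * \<phi>)) = cis (of_int (m - m') * \<phi>)"
      by (simp add: cis_cnj cis_mult algebra_simps)
    then show ?thesis by (simp add: harmonic_def zeta_sph A_def mult_ac)
  qed
  ultimately have "L2_inner (harmonic m k) (harmonic m' k') =
      (LINT \<theta>:{0..pi}|lborel. sin \<theta> *\<^sub>R A \<theta>) * (LINT \<phi>:{0..2 * pi}|lborel. cis (of_int (m - m') * \<phi>))"
    unfolding L2_inner_def by (intro S2_integral_separated) auto
  then show ?thesis using integral_cis_period[of "m - m'"] False by simp
next
  case True
  then have kk: "k \<noteq> k'" using assms by simp
  define M where "M = nat \<bar>m\<bar>"
  define lam where "lam k = real (M + k) * (real (M + k) + 1)" for k
  define W where "W = [:1, 0, -1:] ^ Suc M * (ultraspherical M k * pderiv (ultraspherical M k') - pderiv (ultraspherical M k) * ultraspherical M k')"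
  have lam: "lam k \<noteq> lam k'"
  proof -
    have "lam k - lam k' = (real k - real k') * (2 * real M + real k + real k' + 1)"
      by (simp add: lam_def algebra_simps)
    moreover have "2 * real M + real k + real k' + 1 > 0" by (simp add: add_nonneg_pos)
    ultimately show ?thesis using kk by auto
  qed
  have "(lam k - lam k') * L2_inner (harmonic m k) (harmonic m' k') =
      (LINT x|S2. of_real (lam k - lam k') * (harmonic m k x * cnj (harmonic m' k' x)))"
    by (simp add: L2_inner_def)
  also have "\<dots> = (LINT x|S2. complex_of_real (poly (pderiv W) (x $ 3)))"
  proof (intro Bochner_Integration.integral_cong refl)
    fix x assume x: "x \<in> space S2"
    have "zeta m x * cnj (zeta m x) = of_real ((1 - (x $ 3)\<^sup>2) ^ M)"
      using cmod_zeta[of x m] x by (simp add: M_def complex_norm_square[symmetric] flip: of_real_power)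
    then have "harmonic m k x * cnj (harmonic m' k' x) =
        of_real ((1 - (x $ 3)\<^sup>2) ^ M * poly (ultraspherical M k) (x $ 3) * poly (ultraspherical M k') (x $ 3))"
      by (simp add: harmonic_def True[symmetric] M_def[symmetric] mult_ac)
    then show "of_real (lam k - lam k') * (harmonic m k x * cnj (harmonic m' k' x)) = of_real (poly (pderiv W) (x $ 3))"
      using ultraspherical_wronskian[of M k k' "x $ 3"] by (simp add: W_def lam_def)
  qed
  also have "\<dots> = of_real (2 * pi * (poly W 1 - poly W (-1)))"
    by (simp only: integral_complex_of_real S2_integral_zonal_pderiv)
  also have "\<dots> = 0" by (simp add: W_def)
  finally show ?thesis using lam by simp
qed

text \<open>If the norm were 0, the ultraspherical polynomial would vanish on the whole interval \<open>(-1, 1)\<close>.\<close>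

lemma harmonic_nonzero: "sqnorm (harmonic m k) > 0"
proof (rule ccontr)
  assume "\<not> 0 < sqnorm (harmonic m k)"
  then have z: "sqnorm (harmonic m k) = 0" using sqnorm_nonneg[of "harmonic m k"] by linarith
  define M where "M = nat \<bar>m\<bar>"
  define p where "p = ultraspherical M k"
  define q where "q t = (1 - t\<^sup>2) ^ M * (poly p t)\<^sup>2" for t
  have qc: "continuous_on S (\<lambda>x. q (g x))" if "continuous_on S g" for S :: "'a :: topological_space set" and g
    using that unfolding q_def by (intro continuous_intros)
  have "sqnorm (harmonic m k) = (LINT x|S2. q (x $ 3))"
    unfolding sqnorm_def
    by (intro Bochner_Integration.integral_cong refl)
      (simp add: harmonic_def norm_mult power_mult_distrib cmod_zeta M_def p_def q_def)
  also have "\<dots> = 2 * pi * (LINT \<theta>:{0..pi}|lborel. sin \<theta> * q (cos \<theta>))"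
    by (rule S2_integral_zonal[OF continuous_imp_S2_integrable[OF qc]]) (intro continuous_intros)
  also have "(LINT \<theta>:{0..pi}|lborel. sin \<theta> * q (cos \<theta>)) = integral {0..pi} (\<lambda>\<theta>. sin \<theta> * q (cos \<theta>))"
    by (rule set_borel_integral_eq_integral[OF borel_integrable_atLeastAtMost'])
      (intro continuous_intros qc)
  finally have "integral {0..pi} (\<lambda>\<theta>. sin \<theta> * q (cos \<theta>)) = 0" using z by simp
  then have *: "\<forall>\<theta>\<in>{0..pi}. sin \<theta> * q (cos \<theta>) = 0"
  proof (subst (asm) integral_eq_0_iff)
    show "continuous_on {0..pi} (\<lambda>\<theta>. sin \<theta> * q (cos \<theta>))" by (intro continuous_intros qc)
    fix \<theta> assume "\<theta> \<in> {0..pi}"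
    then show "0 \<le> sin \<theta> * q (cos \<theta>)"
      by (auto simp: q_def sin_ge_zero sin_squared_eq[symmetric] intro!: mult_nonneg_nonneg)
  qed simp
  have "poly p t = 0" if "t \<in> {-1<..<1}" for t
  proof -
    have t: "arccos t \<in> {0<..<pi}" "cos (arccos t) = t"
      using that arccos_lt_bounded[of t] by (auto simp: cos_arccos)
    have "sin (arccos t) > 0" using t by (auto intro: sin_gt_zero)
    moreover have "1 - t\<^sup>2 > 0" using that abs_square_less_1[of t] by (simp add: abs_less_iff)
    ultimately show ?thesis using bspec[OF *, of "arccos t"] t by (auto simp: q_def)
  qed
  then have "{-1<..<1} \<subseteq> {t. poly p t = 0}" by auto
  moreover have "infinite {-1<..<1 :: real}" by simp
  ultimately have "p = 0" using poly_roots_finite finite_subset by blast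
  then show False using ultraspherical_nonzero by (simp add: p_def)
qed

section \<open>Completeness of the spherical harmonics\<close>

text \<open>On the sphere \<open>(x + iy)(x - iy) = 1 - z\<^sup>2\<close>, so a product of azimuthal factors of opposite sign is
  again one azimuthal factor times a polynomial in \<open>z\<close>.\<close>

lemma zeta_mult:
  "\<exists>j. \<forall>x\<in>sphere 0 1. zeta s x * zeta m x = zeta (s + m) x * of_real ((1 - (x $ 3)\<^sup>2) ^ j)"
proof -
  \<comment> \<open>The cancellation is \<open>min \<bar>s\<bar> \<bar>m\<bar>\<close> for opposite signs, and there is none for equal signs.\<close>
  have "\<exists>j. nat \<bar>s\<bar> + nat \<bar>m\<bar> = nat \<bar>s + m\<bar> + 2 * j"
    by (rule exI[of _ "if 0 \<le> s \<longleftrightarrow> 0 \<le> m then 0 else nat (min \<bar>s\<bar> \<bar>m\<bar>)"]) auto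
  then obtain j where j: "nat \<bar>s\<bar> + nat \<bar>m\<bar> = nat \<bar>s + m\<bar> + 2 * j" by blast
  have "zeta s x * zeta m x = zeta (s + m) x * of_real ((1 - (x $ 3)\<^sup>2) ^ j)" if x: "x \<in> sphere 0 1" for x
  proof -
    obtain \<theta> \<phi> where x: "x = sph \<theta> \<phi>" using sphere_cases[OF x] .
    have "sin \<theta> ^ nat \<bar>s\<bar> * sin \<theta> ^ nat \<bar>m\<bar> = sin \<theta> ^ nat \<bar>s + m\<bar> * (1 - (cos \<theta>)\<^sup>2) ^ j"
      unfolding power_add[symmetric] j by (simp add: power_add power_mult sin_squared_eq)
    moreover have "cis (of_int s * \<phi>) * cis (of_int m * \<phi>) = cis (of_int (s + m) * \<phi>)"
      by (simp add: cis_mult algebra_simps)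
    moreover have "zeta s x * zeta m x = of_real (sin \<theta> ^ nat \<bar>s\<bar> * sin \<theta> ^ nat \<bar>m\<bar>) *
        (cis (of_int s * \<phi>) * cis (of_int m * \<phi>))"
      unfolding x zeta_sph by (simp add: mult_ac)
    ultimately show ?thesis
      unfolding x zeta_sph by (simp add: mult_ac)
  qed
  then show ?thesis by blast
qed

text \<open>Finite sums of modes \<open>e\<^sup>i\<^sup>m\<^sup>\<phi> sin\<^sup>\<bar>\<^sup>m\<^sup>\<bar> \<theta> q(cos \<theta>)\<close> on the sphere.  This space contains all polynomials and
  has the spherical harmonics as a basis.\<close>

inductive azimuthal_sum :: "(real^3 \<Rightarrow> complex) \<Rightarrow> bool" where
  mode: "azimuthal_sum (\<lambda>x. c * (zeta m x * of_real (poly q (x $ 3))))"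
| add: "azimuthal_sum u \<Longrightarrow> azimuthal_sum v \<Longrightarrow> azimuthal_sum (\<lambda>x. u x + v x)"
| cong: "azimuthal_sum u \<Longrightarrow> (\<And>x. x \<in> sphere 0 1 \<Longrightarrow> v x = u x) \<Longrightarrow> azimuthal_sum v"

lemma azimuthal_sum_mult_mode:
  assumes "azimuthal_sum u"
  shows "azimuthal_sum (\<lambda>x. (c * (zeta s x * of_real (poly r (x $ 3)))) * u x)"
  using assms
proof induction
  case (mode d m q)
  obtain j where j: "\<And>x. x \<in> sphere 0 1 \<Longrightarrow> zeta s x * zeta m x = zeta (s + m) x * of_real ((1 - (x $ 3)\<^sup>2) ^ j)"
    using zeta_mult by blast
  show ?case
  proof (rule azimuthal_sum.cong[OF azimuthal_sum.mode[of "c * d" "s + m" "[:1, 0, -1:] ^ j * (r * q)"]])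
    fix x :: "real^3" assume x: "x \<in> sphere 0 1"
    have "c * (zeta s x * of_real (poly r (x $ 3))) * (d * (zeta m x * of_real (poly q (x $ 3)))) =
        c * d * ((zeta s x * zeta m x) * (of_real (poly r (x $ 3)) * of_real (poly q (x $ 3))))"
      by (simp only: mult_ac)
    also have "\<dots> = c * d * (zeta (s + m) x * of_real (poly ([:1, 0, -1:] ^ j * (r * q)) (x $ 3)))"
      unfolding j[OF x] by (simp add: poly_power power2_eq_square mult_ac)
    finally show "c * (zeta s x * of_real (poly r (x $ 3))) * (d * (zeta m x * of_real (poly q (x $ 3)))) =
        c * d * (zeta (s + m) x * of_real (poly ([:1, 0, -1:] ^ j * (r * q)) (x $ 3)))" .
  qed
next
  case (add u v)
  then show ?case unfolding distrib_left by (intro azimuthal_sum.add)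
next
  case (cong u v)
  then show ?case by (elim azimuthal_sum.cong) simp
qed

lemma azimuthal_sum_scale: "azimuthal_sum u \<Longrightarrow> azimuthal_sum (\<lambda>x. c * u x)"
  using azimuthal_sum_mult_mode[of u c 0 "[:1:]"] by (simp add: zeta_def)

text \<open>It suffices to multiply by linear functions, and \<open>x\<close> and \<open>y\<close> are combinations of \<open>x + iy\<close> and
  \<open>x - iy\<close>.  Stating the closure for an arbitrary factor \<open>u\<close> is what makes products of polynomials
  go through in the induction.\<close>

lemma azimuthal_sum_mult_polynomial:
  assumes "real_polynomial_function p" "azimuthal_sum u"
  shows "azimuthal_sum (\<lambda>x. of_real (p x) * u x)"
  using assms
proof (induction arbitrary: u)
  case (linear f)
  interpret bounded_linear f by fact
  have u1: "azimuthal_sum (\<lambda>x. 1 * (zeta s x * of_real (poly [:1:] (x $ 3))) * u x)" for s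
    using linear.prems by (rule azimuthal_sum_mult_mode)
  have u2: "azimuthal_sum (\<lambda>x. 1 * (zeta 0 x * of_real (poly [:0, 1:] (x $ 3))) * u x)"
    using linear.prems by (rule azimuthal_sum_mult_mode)
  let ?a = "f (axis 1 1)" and ?b = "f (axis 2 1)" and ?c = "f (axis 3 1)"
  have "azimuthal_sum (\<lambda>x.
      ((of_real ?a - \<i> * of_real ?b) / 2) * (1 * (zeta 1 x * of_real (poly [:1:] (x $ 3))) * u x)
      + (((of_real ?a + \<i> * of_real ?b) / 2) * (1 * (zeta (-1) x * of_real (poly [:1:] (x $ 3))) * u x)
      + of_real ?c * (1 * (zeta 0 x * of_real (poly [:0, 1:] (x $ 3))) * u x)))"
    by (intro azimuthal_sum.add azimuthal_sum_scale u1 u2)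
  then show ?case
  proof (rule azimuthal_sum.cong)
    fix x :: "real^3"
    have "x = x $ 1 *\<^sub>R axis 1 1 + x $ 2 *\<^sub>R axis 2 1 + x $ 3 *\<^sub>R axis 3 1"
      by (simp add: vec_eq_iff forall_3 axis_def)
    then have 1: "f x = x $ 1 * ?a + x $ 2 * ?b + x $ 3 * ?c"
      by (metis add scaleR real_scaleR_def)
    have 2: "zeta 1 x = of_real (x $ 1) + \<i> * of_real (x $ 2)"
        "zeta (-1) x = of_real (x $ 1) - \<i> * of_real (x $ 2)" "zeta 0 x = 1"
      by (simp_all add: zeta_def complex_eq_iff)
    show "of_real (f x) * u x =
      ((of_real ?a - \<i> * of_real ?b) / 2) * (1 * (zeta 1 x * of_real (poly [:1:] (x $ 3))) * u x)
      + (((of_real ?a + \<i> * of_real ?b) / 2) * (1 * (zeta (-1) x * of_real (poly [:1:] (x $ 3))) * u x)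
      + of_real ?c * (1 * (zeta 0 x * of_real (poly [:0, 1:] (x $ 3))) * u x))"
      unfolding 1 2 by (simp add: field_simps)
  qed
next
  case (const c)
  then show ?case by (rule azimuthal_sum_scale)
next
  case (add f g)
  then show ?case unfolding of_real_add distrib_right by (intro azimuthal_sum.add) auto
next
  case (mult f g)
  then show ?case unfolding of_real_mult mult.assoc by auto
qed

corollary azimuthal_sum_polynomial:
  assumes "real_polynomial_function p"
  shows "azimuthal_sum (\<lambda>x. of_real (p x))"
proof -
  have "azimuthal_sum (\<lambda>x. 1)" using azimuthal_sum.mode[of 1 0 "[:1:]"] by (simp add: zeta_def)
  from azimuthal_sum_mult_polynomial[OF assms this] show ?thesis by simp
qed

text \<open>The normalizing factors \<open>\<kappa>\<close> stay arbitrary, because the phase of the highest weight harmonics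
  is prescribed by the functions that the basis has to contain.\<close>

definition harmonic_seq :: "(int \<Rightarrow> nat \<Rightarrow> complex) \<Rightarrow> nat \<Rightarrow> real^3 \<Rightarrow> complex" where
  "harmonic_seq \<kappa> n x = (case prod_decode n of (a, k) \<Rightarrow> \<kappa> (int_decode a) k * harmonic (int_decode a) k x)"

definition harmonic_index :: "int \<Rightarrow> nat \<Rightarrow> nat" where
  "harmonic_index m k = prod_encode (int_encode m, k)"

lemma harmonic_seq_index [simp]: "harmonic_seq \<kappa> (harmonic_index m k) = (\<lambda>x. \<kappa> m k * harmonic m k x)"
  by (simp add: harmonic_seq_def harmonic_index_def fun_eq_iff)

lemma harmonic_index_cases: obtains m k where "n = harmonic_index m k"
proof -
  have "n = harmonic_index (int_decode (fst (prod_decode n))) (snd (prod_decode n))"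
    by (simp add: harmonic_index_def)
  then show ?thesis using that by blast
qed

lemma harmonic_index_eq_iff [simp]: "harmonic_index m k = harmonic_index m' k' \<longleftrightarrow> m = m' \<and> k = k'"
  by (simp add: harmonic_index_def inj_eq[OF inj_int_encode])

text \<open>Completeness: for fixed \<open>m\<close> the ultraspherical polynomials have every degree exactly once, so by
  induction on the degree they span all polynomials in \<open>z\<close>.  Hence every mode, every azimuthal sum
  and every polynomial is expandable.\<close>

theorem harmonic_eigenbasis:
  assumes normalized: "\<And>m k. (cmod (\<kappa> m k))\<^sup>2 * sqnorm (harmonic m k) = 1"
  shows "\<exists>\<mu>. laplace_eigenbasis (harmonic_seq \<kappa>) \<mu>"
proof -
  interpret L2_orthonormal "harmonic_seq \<kappa>"
  proof
    fix n n'
    obtain m k where n: "n = harmonic_index m k" by (rule harmonic_index_cases)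
    obtain m' k' where n': "n' = harmonic_index m' k'" by (rule harmonic_index_cases)
    show "L2_fun (harmonic_seq \<kappa> n)"
      by (simp add: n L2_fun_scale L2_fun_harmonic)
    show "L2_inner (harmonic_seq \<kappa> n) (harmonic_seq \<kappa> n') = (if n = n' then 1 else 0)"
    proof (cases "n = n'")
      case True
      then show ?thesis
        using normalized[of m k] by (simp add: n L2_inner_self sqnorm_scale flip: True)
    next
      case False
      then have "L2_inner (harmonic m k) (harmonic m' k') = 0"
        by (intro harmonic_orthogonal) (auto simp: n n')
      then have "L2_inner (harmonic_seq \<kappa> n) (harmonic m' k') = 0"
        by (simp add: n L2_inner_scale_left)
      then have "L2_inner (harmonic m' k') (harmonic_seq \<kappa> n) = 0"
        by (subst L2_inner_cnj) simp
      then have "L2_inner (harmonic_seq \<kappa> n') (harmonic_seq \<kappa> n) = 0"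
        by (simp add: n' L2_inner_scale_left)
      then show ?thesis using False by (subst L2_inner_cnj) simp
    qed
  qed
  have expandable_mode: "expandable (\<lambda>x. c * (zeta m x * of_real (poly q (x $ 3))))"
    if "\<And>i. n \<le> i \<Longrightarrow> coeff q i = 0" for n c m q
    using that
  proof (induction n arbitrary: c q)
    case 0
    then have "q = 0" by (simp add: poly_eq_iff)
    then show ?case using expandable_scale[OF expandable_basis, of 0] by simp
  next
    case (Suc n)
    define p where "p = ultraspherical (nat \<bar>m\<bar>) n"
    have p: "coeff p n \<noteq> 0" "\<And>i. n < i \<Longrightarrow> coeff p i = 0"
      using degree_ultraspherical[of "nat \<bar>m\<bar>" n] ultraspherical_nonzero[of "nat \<bar>m\<bar>" n]
      by (auto simp: p_def coeff_eq_0 dest: leading_coeff_neq_0)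
    \<comment> \<open>Cancel the leading coefficient against the harmonic of the same degree.\<close>
    define a where "a = coeff q n / coeff p n"
    have k0: "\<kappa> m n \<noteq> 0" using normalized[of m n] by auto
    have "coeff (q - smult a p) i = 0" if "n \<le> i" for i
      using that Suc.prems[of i] p by (cases "i = n") (auto simp: a_def)
    then have "expandable (\<lambda>x. c * (zeta m x * of_real (poly (q - smult a p) (x $ 3))))"
      by (rule Suc.IH)
    moreover have "expandable (\<lambda>x. (c * of_real a / \<kappa> m n) * harmonic_seq \<kappa> (harmonic_index m n) x)"
      by (intro expandable_scale expandable_basis)
    ultimately have "expandable (\<lambda>x. c * (zeta m x * of_real (poly (q - smult a p) (x $ 3))) +
        (c * of_real a / \<kappa> m n) * harmonic_seq \<kappa> (harmonic_index m n) x)"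
      by (rule expandable_add)
    moreover have "c * (zeta m x * of_real (poly (q - smult a p) (x $ 3))) +
        (c * of_real a / \<kappa> m n) * harmonic_seq \<kappa> (harmonic_index m n) x =
        c * (zeta m x * of_real (poly q (x $ 3)))" for x
      using k0 by (simp add: harmonic_def p_def algebra_simps)
    ultimately show ?case by simp
  qed
  have "expandable u" if "azimuthal_sum u" for u
    using that
  proof induction
    case (mode c m q)
    show ?case by (rule expandable_mode[of "Suc (degree q)"]) (simp add: coeff_eq_0)
  next
    case (add u v)
    then show ?case by (intro expandable_add)
  next
    case (cong u v)
    then have "L2_fun v" using L2_fun_cong[of v u] by (simp add: expandable_def)
    with cong show ?case by (intro expandable_cong[of u v]) auto
  qed
  then have "orthonormal_basis (harmonic_seq \<kappa>)"
    using azimuthal_sum_polynomial by (intro orthonormal_basisI) blast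
  moreover have "\<exists>\<mu>\<ge>0. laplace_eigenfunction \<mu> (harmonic_seq \<kappa> n)" for n
  proof -
    obtain m k where n: "n = harmonic_index m k" by (rule harmonic_index_cases)
    show ?thesis
      unfolding n harmonic_seq_index
      by (intro exI conjI, rule_tac [2] harmonic_eigenfunction) simp
  qed
  then obtain \<mu> where "\<And>n. 0 \<le> \<mu> n \<and> laplace_eigenfunction (\<mu> n) (harmonic_seq \<kappa> n)" by metis
  ultimately show ?thesis by (auto simp: laplace_eigenbasis_def)
qed

section \<open>Concentration near the equator\<close>

lemma integrable_zonal_power: "integrable S2 (\<lambda>x. (1 - (x $ 3)\<^sup>2) ^ l)"
  by (intro continuous_imp_S2_integrable continuous_intros)

text \<open>The difference of the two sides is the integral of the derivative of \<open>z (1 - z\<^sup>2)\<^sup>l\<^sup>+\<^sup>1\<close>, which vanishes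
  at both poles.\<close>

lemma zonal_power_second_moment:
  "(2 * real l + 3) * (LINT x|S2. (x $ 3)\<^sup>2 * (1 - (x $ 3)\<^sup>2) ^ l) = (LINT x|S2. (1 - (x $ 3)\<^sup>2) ^ l)"
proof -
  define g where "g = [:0, 1:] * [:1, 0, -1 :: real:] ^ Suc l"
  have int: "integrable S2 (\<lambda>x. (2 * real l + 3) * ((x $ 3)\<^sup>2 * (1 - (x $ 3)\<^sup>2) ^ l))"
    by (intro continuous_imp_S2_integrable continuous_intros)
  have "poly (pderiv g) t = (1 - t\<^sup>2) ^ l - (2 * real l + 3) * (t\<^sup>2 * (1 - t\<^sup>2) ^ l)" for t
    unfolding g_def pderiv_mult pderiv_power_Suc
    by (simp add: pderiv_pCons power2_eq_square algebra_simps)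
  then have "(LINT x|S2. poly (pderiv g) (x $ 3)) =
      (LINT x|S2. (1 - (x $ 3)\<^sup>2) ^ l) - (LINT x|S2. (2 * real l + 3) * ((x $ 3)\<^sup>2 * (1 - (x $ 3)\<^sup>2) ^ l))"
    by (simp only: Bochner_Integration.integral_diff[OF integrable_zonal_power int])
  moreover have "(LINT x|S2. poly (pderiv g) (x $ 3)) = 0"
    by (simp add: S2_integral_zonal_pderiv g_def)
  ultimately show ?thesis by simp
qed

lemma sphere_height:
  assumes "x \<in> sphere (0 :: real^3) 1"
  shows "0 \<le> 1 - (x $ 3)\<^sup>2" "1 - (x $ 3)\<^sup>2 \<le> 1"
proof -
  have "(x $ 1)\<^sup>2 + (x $ 2)\<^sup>2 + (x $ 3)\<^sup>2 = 1" using assms by (simp add: norm_eq_1_iff)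
  then show "0 \<le> 1 - (x $ 3)\<^sup>2" "1 - (x $ 3)\<^sup>2 \<le> 1"
    using zero_le_power2[of "x $ 1"] zero_le_power2[of "x $ 2"] by (linarith, simp)
qed

lemma zonal_power_bernoulli:
  assumes "x \<in> sphere (0 :: real^3) 1"
  shows "1 - real l * (x $ 3)\<^sup>2 \<le> (1 - (x $ 3)\<^sup>2) ^ l"
  using Bernoulli_inequality[of "- (x $ 3)\<^sup>2" l] sphere_height[OF assms] by simp

lemma zonal_power_bounds:
  assumes "norm (x :: real^3) = 1"
  shows "0 \<le> (1 - (x $ 3)\<^sup>2) ^ l" "(1 - (x $ 3)\<^sup>2) ^ l \<le> 1"
  using sphere_height[of x] assms by (simp_all add: power_le_one)

text \<open>Chebyshev's inequality: the normalized density \<open>(1 - z\<^sup>2)\<^sup>l\<close> has variance \<open>1 / (2 l + 3)\<close>, so at most the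
  fraction \<open>l / (2 l + 3) < 1/2\<close> of the mass has \<open>z\<^sup>2 > 1/l\<close>.\<close>

lemma zonal_power_mass_band:
  assumes l: "l \<ge> 1"
  shows "(LINT x:band (1 / sqrt l)|S2. (1 - (x $ 3)\<^sup>2) ^ l) \<ge> (LINT x|S2. (1 - (x $ 3)\<^sup>2) ^ l) / 2"
proof -
  let ?g = "\<lambda>x :: real^3. (1 - (x $ 3)\<^sup>2) ^ l"
  let ?I = "LINT x|S2. ?g x"
  have int: "integrable S2 (\<lambda>x. real l * ((x $ 3)\<^sup>2 * ?g x))"
    by (intro continuous_imp_S2_integrable continuous_intros)
  have I0: "0 \<le> ?I" by (intro integral_nonneg_AE AE_I2) (simp add: zonal_power_bounds)
  have "?I / 2 \<le> ?I - real l * (?I / (2 * real l + 3))"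
    using I0 by (simp add: field_simps)
  also have "\<dots> = ?I - (LINT x|S2. real l * ((x $ 3)\<^sup>2 * ?g x))"
    using zonal_power_second_moment[of l] by (simp add: field_simps)
  also have "\<dots> = (LINT x|S2. ?g x - real l * ((x $ 3)\<^sup>2 * ?g x))"
    by (rule Bochner_Integration.integral_diff[OF integrable_zonal_power int, symmetric])
  also have "\<dots> \<le> (LINT x|S2. indicator (band (1 / sqrt l)) x *\<^sub>R ?g x)"
  proof (rule integral_mono)
    show "integrable S2 (\<lambda>x. indicator (band (1 / sqrt l)) x *\<^sub>R ?g x)"
      by (intro integrable_mult_indicator band_sets integrable_zonal_power)
    show "integrable S2 (\<lambda>x. ?g x - real l * ((x $ 3)\<^sup>2 * ?g x))"
      by (intro Bochner_Integration.integrable_diff int integrable_zonal_power)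
    fix x assume x: "x \<in> space S2"
    then have g0: "0 \<le> ?g x" by (simp add: zonal_power_bounds)
    show "?g x - real l * ((x $ 3)\<^sup>2 * ?g x) \<le> indicator (band (1 / sqrt l)) x *\<^sub>R ?g x"
    proof (cases "x \<in> band (1 / sqrt l)")
      case True
      then show ?thesis using g0 by simp
    next
      case False
      then have "1 / sqrt l < \<bar>x $ 3\<bar>" using x by (simp add: band_def)
      then have "(1 / sqrt l)\<^sup>2 < (x $ 3)\<^sup>2" using l by (subst power2_abs[of "x $ 3", symmetric]) (intro power_strict_mono, auto)
      then have "1 \<le> real l * (x $ 3)\<^sup>2" using l by (simp add: power_divide field_simps)
      then have "1 * ?g x \<le> (real l * (x $ 3)\<^sup>2) * ?g x" by (intro mult_right_mono g0)
      then show ?thesis using False by (simp add: mult_ac)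
    qed
  qed
  finally show ?thesis by (simp add: set_lebesgue_integral_def)
qed

text \<open>At least half of the mass sits in a band of area \<open>4 pi / sqrt l\<close>, where the density is at most 1.\<close>

lemma zonal_power_mass_upper:
  assumes l: "l \<ge> 1"
  shows "(LINT x|S2. (1 - (x $ 3)\<^sup>2) ^ l) \<le> 8 * pi / sqrt l"
proof -
  let ?g = "\<lambda>x :: real^3. (1 - (x $ 3)\<^sup>2) ^ l" and ?E = "band (1 / sqrt l)"
  have "(LINT x|S2. ?g x) / 2 \<le> (LINT x|S2. indicator ?E x *\<^sub>R ?g x)"
    using zonal_power_mass_band[OF l] by (simp add: set_lebesgue_integral_def)
  also have "\<dots> \<le> (LINT x|S2. indicator ?E x)"
  proof (rule integral_mono)
    show "integrable S2 (\<lambda>x. indicator ?E x *\<^sub>R ?g x)"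
      by (intro integrable_mult_indicator band_sets integrable_zonal_power)
    show "integrable S2 (indicator ?E :: _ \<Rightarrow> real)"
      using band_sets by (auto simp: S2.emeasure_finite less_top[symmetric])
    fix x assume "x \<in> space S2"
    then show "indicator ?E x *\<^sub>R ?g x \<le> indicator ?E x"
      by (simp add: indicator_def zonal_power_bounds)
  qed
  also have "\<dots> = measure S2 ?E"
    using sets.sets_into_space[OF band_sets] by (simp add: Int_absorb2)
  also have "\<dots> = 4 * pi / sqrt l" using l by (simp add: measure_band)
  finally show ?thesis by simp
qed

text \<open>By Bernoulli's inequality the density is at least \<open>1 - l z\<^sup>2 \<ge> 1/2\<close> for \<open>\<bar>z\<bar> \<le> 1 / (2 sqrt l)\<close>.\<close>

lemma zonal_power_mass_lower:
  assumes l: "l \<ge> 1"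
  shows "pi / sqrt l \<le> (LINT x|S2. (1 - (x $ 3)\<^sup>2) ^ l)"
proof -
  let ?g = "\<lambda>x :: real^3. (1 - (x $ 3)\<^sup>2) ^ l" and ?E = "band (1 / (2 * sqrt l))"
  have "1 \<le> sqrt (real l)" using l by simp
  then have "1 \<le> 2 * sqrt (real l)" by linarith
  then have "1 / (2 * sqrt l) \<le> 1" using l by (subst divide_le_eq_1_pos) auto
  then have "1 / 2 * (4 * pi * (1 / (2 * sqrt l))) = 1 / 2 * measure S2 ?E"
    by (subst measure_band) simp_all
  also have "\<dots> = (LINT x|S2. 1 / 2 * indicator ?E x)"
    using sets.sets_into_space[OF band_sets] by (simp add: Int_absorb2)
  also have "\<dots> \<le> (LINT x|S2. ?g x)"
  proof (rule integral_mono[OF _ integrable_zonal_power])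
    show "integrable S2 (\<lambda>x. 1 / 2 * indicator ?E x :: real)"
      using band_sets by (auto simp: S2.emeasure_finite less_top[symmetric])
    fix x assume x: "x \<in> space S2"
    show "1 / 2 * indicator ?E x \<le> ?g x"
    proof (cases "x \<in> ?E")
      case True
      then have "\<bar>x $ 3\<bar> \<le> 1 / (2 * sqrt l)" by (simp add: band_def)
      then have "(x $ 3)\<^sup>2 \<le> (1 / (2 * sqrt l))\<^sup>2"
        by (subst power2_abs[of "x $ 3", symmetric]) (intro power_mono, auto)
      then have "real l * (x $ 3)\<^sup>2 \<le> 1 / 2" using l by (simp add: power_divide power_mult_distrib field_simps)
      then show ?thesis using zonal_power_bernoulli[of x l] x True by simp
    next
      case False
      then show ?thesis using x by (simp add: zonal_power_bounds)
    qed
  qed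
  finally show ?thesis by simp
qed

section \<open>Sharpness of the defect factor\<close>

theorem theorem1p3:
  fixes f :: "nat \<Rightarrow> real^3 \<Rightarrow> complex" and c :: "nat \<Rightarrow> complex"
  assumes f_coords: "\<And>l \<theta> \<phi>. l \<ge> 1 \<Longrightarrow> \<theta> \<in> {0..pi} \<Longrightarrow> \<phi> \<in> {0..2 * pi} \<Longrightarrow>
      f l (sph \<theta> \<phi>) = c l * exp (\<i> * of_nat l * of_real \<phi>) * of_real (sin \<theta>) ^ l"
    and f_normalized: "\<And>l. l \<ge> 1 \<Longrightarrow> L2_norm (f l) = 1"
  shows "comparable (\<lambda>l. SUP x\<in>sphere 0 1. (cmod (f l x))\<^sup>2) (\<lambda>l. real l powr (1/2)) \<and>
    (\<exists>E :: nat \<Rightarrow> (real^3) set.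
      (\<forall>l\<ge>1. E l \<in> sets S2 \<and> (LINT x:E l|S2. (cmod (f l x))\<^sup>2) \<ge> 1/2) \<and>
      comparable (\<lambda>l. measure S2 (E l)) (\<lambda>l. real l powr (-1/2)) \<and>
      comparable (\<lambda>l. measure S2 (E l) * (SUP x\<in>E l. (cmod (f l x))\<^sup>2)) (\<lambda>l. 1) \<and>
      (\<exists>e \<mu> j. laplace_eigenbasis e \<mu> \<and>
        (\<forall>l\<ge>1. \<forall>x\<in>sphere 0 1. e (j l) x = f l x) \<and>
        (\<forall>D :: nat set \<Rightarrow> (real^3) set \<Rightarrow> real.
          (\<lambda>l. D {j l} (E l)) \<in> o(\<lambda>l. defect_factor e {j l} (E l)) \<longrightarrow>
          \<not> uncertainty_inequality e D)))"
proof -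
  define E where "E l = band (1 / sqrt (real l))" for l :: nat
  define B where "B l = (cmod (c l))\<^sup>2" for l
  have f_eq: "f l x = c l * zeta (int l) x" if l: "l \<ge> 1" and x: "x \<in> sphere 0 1" for l x
  proof -
    obtain \<theta> \<phi> where x: "\<theta> \<in> {0..pi}" "\<phi> \<in> {0..2 * pi}" "x = sph \<theta> \<phi>" by (rule sphere_cases[OF x])
    show ?thesis
      using f_coords[OF l x(1,2)] by (simp add: x(3) zeta_sph cis_conv_exp mult_ac)
  qed
  have f_sq: "(cmod (f l x))\<^sup>2 = B l * (1 - (x $ 3)\<^sup>2) ^ l" if "l \<ge> 1" "x \<in> sphere 0 1" for l x
    using f_eq[OF that] cmod_zeta[OF that(2), of "int l"] by (simp add: norm_mult power_mult_distrib B_def)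
  have f_sqnorm: "sqnorm (f l) = 1" if "l \<ge> 1" for l
    using f_normalized[OF that] by (simp add: L2_norm_eq)
  have B_mass: "B l * (LINT x|S2. (1 - (x $ 3)\<^sup>2) ^ l) = 1" if l: "l \<ge> 1" for l
  proof -
    have "sqnorm (f l) = (LINT x|S2. B l * (1 - (x $ 3)\<^sup>2) ^ l)"
      unfolding sqnorm_def by (intro Bochner_Integration.integral_cong refl) (simp add: f_sq[OF l])
    then show ?thesis using f_sqnorm[OF l] by simp
  qed
  have B0: "0 \<le> B l" for l by (simp add: B_def)
  have B_upper: "B l \<le> sqrt l / pi" if l: "l \<ge> 1" for l
  proof -
    have "B l * (pi / sqrt l) \<le> 1"
      using mult_left_mono[OF zonal_power_mass_lower[OF l] B0[of l]] B_mass[OF l] by simp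
    then show ?thesis using l by (simp add: field_simps)
  qed
  have B_lower: "sqrt l / (8 * pi) \<le> B l" if l: "l \<ge> 1" for l
  proof -
    have "1 \<le> B l * (8 * pi / sqrt l)"
      using mult_left_mono[OF zonal_power_mass_upper[OF l] B0[of l]] B_mass[OF l] by simp
    then show ?thesis using l by (simp add: field_simps)
  qed
  have sup_f: "(SUP x\<in>A. (cmod (f l x))\<^sup>2 * a) = B l * a"
    if l: "l \<ge> 1" and A: "band 0 \<subseteq> A" "A \<subseteq> sphere 0 1" and a: "0 \<le> a" for l A a
  proof (rule cSup_eq_maximum)
    have "sph (pi / 2) 0 \<in> A" using A(1) by (auto simp: band_def)
    moreover have "(cmod (f l (sph (pi / 2) 0)))\<^sup>2 = B l" using l by (simp add: f_sq)
    ultimately show "B l * a \<in> (\<lambda>x. (cmod (f l x))\<^sup>2 * a) ` A" by force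
  next
    fix y assume "y \<in> (\<lambda>x. (cmod (f l x))\<^sup>2 * a) ` A"
    then obtain x where x: "x \<in> sphere 0 1" "y = (cmod (f l x))\<^sup>2 * a" using A(2) by auto
    have "(1 - (x $ 3)\<^sup>2) ^ l \<le> 1" using sphere_height[OF x(1)] by (intro power_le_one)
    then have "(cmod (f l x))\<^sup>2 \<le> B l"
      using f_sq[OF l x(1)] mult_left_mono[of _ 1 "B l"] B0 by simp
    then show "y \<le> B l * a" using a by (simp add: x mult_right_mono)
  qed
  have E_sub: "band 0 \<subseteq> E l" "E l \<subseteq> sphere 0 1" for l by (auto simp: E_def band_def)
  have measure_E: "measure S2 (E l) = 4 * pi / sqrt l" if "l \<ge> 1" for l
    using that by (simp add: E_def measure_band)
  have E_mass: "(LINT x:E l|S2. (cmod (f l x))\<^sup>2) \<ge> 1/2" if l: "l \<ge> 1" for l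
  proof -
    have "1 / 2 \<le> B l * (LINT x:E l|S2. (1 - (x $ 3)\<^sup>2) ^ l)"
      using mult_left_mono[OF zonal_power_mass_band[OF l] B0[of l]] B_mass[OF l] by (simp add: E_def)
    also have "\<dots> = (LINT x:E l|S2. B l * (1 - (x $ 3)\<^sup>2) ^ l)" by simp
    also have "\<dots> = (LINT x:E l|S2. (cmod (f l x))\<^sup>2)"
      unfolding set_lebesgue_integral_def
      by (intro Bochner_Integration.integral_cong refl) (simp add: f_sq[OF l] indicator_def E_def band_def)
    finally show ?thesis .
  qed
  have C1: "comparable (\<lambda>l. SUP x\<in>sphere 0 1. (cmod (f l x))\<^sup>2) (\<lambda>l. real l powr (1/2))"
    unfolding comparable_def
  proof (intro exI[of _ "8 * pi"] conjI allI impI)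
    fix l :: nat assume l: "1 \<le> l"
    have sup: "(SUP x\<in>sphere 0 1. (cmod (f l x))\<^sup>2) = B l"
      using sup_f[OF l _ order_refl, of 1] by (simp add: band_def subset_iff)
    show "inverse (8 * pi) * real l powr (1/2) \<le> (SUP x\<in>sphere 0 1. (cmod (f l x))\<^sup>2)"
      unfolding sup using B_lower[OF l] by (simp add: powr_half_sqrt field_simps)
    have "sqrt l / pi \<le> sqrt l / 1" using pi_gt3 by (intro divide_left_mono) auto
    also have "\<dots> \<le> 8 * pi * sqrt l" using pi_gt3 mult_right_mono[of 1 "8 * pi" "sqrt l"] by simp
    finally show "(SUP x\<in>sphere 0 1. (cmod (f l x))\<^sup>2) \<le> 8 * pi * real l powr (1/2)"
      unfolding sup using B_upper[OF l] by (simp add: powr_half_sqrt)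
  qed simp
  have powr_neg: "real l powr (-1/2) = 1 / sqrt l" for l
    using powr_minus_divide[of "real l" "1/2"] by (simp add: powr_half_sqrt)
  have C2: "comparable (\<lambda>l. measure S2 (E l)) (\<lambda>l. real l powr (-1/2))"
    unfolding comparable_def
  proof (intro exI[of _ "4 * pi"] conjI allI impI)
    fix l :: nat assume l: "1 \<le> l"
    have pi: "1 \<le> 4 * pi" using pi_gt3 by linarith
    then have "inverse (4 * pi) \<le> inverse 1" by (rule le_imp_inverse_le) simp
    then have "inverse (4 * pi) \<le> 4 * pi" using pi by simp
    then have "inverse (4 * pi) * (1 / sqrt l) \<le> 4 * pi * (1 / sqrt l)" by (intro mult_right_mono) auto
    then show "inverse (4 * pi) * real l powr (-1/2) \<le> measure S2 (E l)"
      unfolding measure_E[OF l] powr_neg by simp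
    show "measure S2 (E l) \<le> 4 * pi * real l powr (-1/2)"
      unfolding measure_E[OF l] powr_neg by simp
  qed simp
  have EB: "1 / 2 \<le> measure S2 (E l) * B l" "measure S2 (E l) * B l \<le> 4" if l: "l \<ge> 1" for l
  proof -
    have "measure S2 (E l) * (sqrt l / (8 * pi)) \<le> measure S2 (E l) * B l"
      by (intro mult_left_mono B_lower l) simp
    then show "1 / 2 \<le> measure S2 (E l) * B l" using l by (simp add: measure_E)
    have "measure S2 (E l) * B l \<le> measure S2 (E l) * (sqrt l / pi)"
      by (intro mult_left_mono B_upper l) simp
    then show "measure S2 (E l) * B l \<le> 4" using l by (simp add: measure_E)
  qed
  have C3: "comparable (\<lambda>l. measure S2 (E l) * (SUP x\<in>E l. (cmod (f l x))\<^sup>2)) (\<lambda>l. 1)"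
    unfolding comparable_def
  proof (intro exI[of _ 4] conjI allI impI)
    fix l :: nat assume l: "1 \<le> l"
    have sup: "(SUP x\<in>E l. (cmod (f l x))\<^sup>2) = B l" using sup_f[OF l E_sub, of 1] by simp
    show "inverse 4 * 1 \<le> measure S2 (E l) * (SUP x\<in>E l. (cmod (f l x))\<^sup>2)"
      "measure S2 (E l) * (SUP x\<in>E l. (cmod (f l x))\<^sup>2) \<le> 4 * 1"
      unfolding sup using EB[OF l] by simp_all
  qed simp
  define a where "a l = coeff (ultraspherical l 0) 0" for l
  have a: "ultraspherical l 0 = [:a l:]" "a l \<noteq> 0" for l
    using degree_ultraspherical[of l 0] ultraspherical_nonzero[of l 0]
    by (auto simp: a_def elim!: degree_eq_zeroE)
  \<comment> \<open>For \<open>m \<ge> 1\<close>, \<open>k = 0\<close> the ultraspherical polynomial is the constant \<open>a\<close>; dividing by it turns the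
    harmonic into \<open>f\<close> with its own phase, while all other harmonics are just normalized.\<close>
  define \<kappa> where "\<kappa> m k = (if 1 \<le> m \<and> k = 0 then c (nat m) / of_real (a (nat m))
      else of_real (1 / sqrt (sqnorm (harmonic m k))))" for m :: int and k :: nat
  have top: "\<kappa> (int l) 0 * harmonic (int l) 0 x = f l x" if "l \<ge> 1" "x \<in> sphere 0 1" for l x
    using f_eq[OF that] that a[of l] by (simp add: \<kappa>_def harmonic_def)
  have "(cmod (\<kappa> m k))\<^sup>2 * sqnorm (harmonic m k) = 1" for m k
  proof (cases "1 \<le> m \<and> k = 0")
    case True
    then obtain l where l: "l \<ge> 1" "m = int l" by (metis nonneg_int_cases of_nat_1 of_nat_le_iff order.trans zero_le_one)
    have "sqnorm (\<lambda>x. \<kappa> (int l) 0 * harmonic (int l) 0 x) = sqnorm (f l)"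
      by (intro sqnorm_cong top l)
    then show ?thesis using f_sqnorm[OF l(1)] True by (simp add: sqnorm_scale l(2))
  next
    case False
    then show ?thesis using harmonic_nonzero[of m k]
      by (auto simp: \<kappa>_def norm_divide power_divide)
  qed
  from harmonic_eigenbasis[OF this] obtain \<mu> where basis: "laplace_eigenbasis (harmonic_seq \<kappa>) \<mu>" by blast
  define e where "e = harmonic_seq \<kappa>"
  define j where "j l = harmonic_index (int l) 0" for l
  have ef: "e (j l) x = f l x" if "l \<ge> 1" "x \<in> sphere 0 1" for l x
    using top[OF that] by (simp add: e_def j_def)
  have e_basis: "laplace_eigenbasis e \<mu>" using basis by (simp add: e_def)
  have e_L2: "L2_fun (e n)" and e_on: "L2_inner (e n) (e n) = 1" for n
    using e_basis by (simp_all add: laplace_eigenbasis_def orthonormal_basis_def)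
  have sharp: "\<not> uncertainty_inequality e D"
    if o: "(\<lambda>l. D {j l} (E l)) \<in> o(\<lambda>l. defect_factor e {j l} (E l))" for D
  proof
    assume ui: "uncertainty_inequality e D"
    \<comment> \<open>Since \<open>\<bar>E\<bar>\<close> times the supremum is at most 4, the factor 1/32 brings the right-hand side of the
    uncertainty inequality down to 1/8, below \<open>(1 - 1/2)\<^sup>2\<close>.\<close>
    from landau_o.smallD[OF o, of "1 / 32"] obtain L where
      L: "\<And>l. l \<ge> L \<Longrightarrow> \<bar>D {j l} (E l)\<bar> \<le> 1 / 32 * \<bar>defect_factor e {j l} (E l)\<bar>"
      by (auto simp: eventually_sequentially)
    define l where "l = max L 1"
    have l: "l \<ge> 1" "l \<ge> L" by (auto simp: l_def)
    have norm: "L2_norm (e (j l)) = 1"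
      using e_on[of "j l"] by (simp add: L2_norm_eq L2_inner_self)
    have "(LINT x:E l|S2. (cmod (e (j l) x))\<^sup>2) = (LINT x:E l|S2. (cmod (f l x))\<^sup>2)"
      unfolding set_lebesgue_integral_def
      by (intro Bochner_Integration.integral_cong refl) (simp add: ef[OF l(1)])
    then have mass: "(LINT x:E l|S2. (cmod (e (j l) x))\<^sup>2) \<ge> 1/2" using E_mass[OF l(1)] by simp
    \<comment> \<open>Test the inequality on \<open>f l\<close> itself, with \<open>\<epsilon> = 1/2\<close> and \<open>\<epsilon>' = 0\<close>.\<close>
    have "(1 - 1/2 - 0)\<^sup>2 \<le> measure S2 (E l) / measure S2 (space S2) * real (card {j l}) * D {j l} (E l)"
    proof (rule ui[unfolded uncertainty_inequality_def, rule_format, of "{j l}" "E l" "e (j l)" "1/2" 0])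
      have "E l \<in> sets S2" by (simp add: E_def band_sets)
      then show "finite {j l} \<and> E l \<in> sets S2 \<and> L2_fun (e (j l)) \<and> L2_norm (e (j l)) \<noteq> 0 \<and>
          0 \<le> (1/2 :: real) \<and> 1/2 < (1 :: real) \<and> 0 \<le> (0 :: real) \<and> 0 < (1 :: real) \<and>
          0 < 1 - 1/2 - (0 :: real) \<and> 1 - 1/2 - 0 \<le> (1 :: real) \<and>
          (1 - 1/2) * (L2_norm (e (j l)))\<^sup>2 \<le> (LINT x:E l|S2. (cmod (e (j l) x))\<^sup>2) \<and>
          (1 - 0) * (L2_norm (e (j l)))\<^sup>2 \<le> (\<Sum>i\<in>{j l}. (cmod (L2_inner (e (j l)) (e i)))\<^sup>2)"
        using mass by (simp add: e_L2 norm e_on)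
    qed
    then have "1 / 4 \<le> measure S2 (E l) / (4 * pi) * D {j l} (E l)"
      by (simp add: measure_S2[simplified] power2_eq_square)
    also have "\<dots> \<le> measure S2 (E l) / (4 * pi) * (1 / 32 * (B l * (4 * pi)))"
    proof (intro mult_left_mono)
      have "defect_factor e {j l} (E l) = (SUP x\<in>E l. (cmod (f l x))\<^sup>2 * (4 * pi))"
        unfolding defect_factor_def spectral_density_def
        using E_sub(2)[of l] by (intro SUP_cong refl) (auto simp: ef[OF l(1)] measure_S2[simplified])
      also have "\<dots> = B l * (4 * pi)" using sup_f[OF l(1) E_sub, of "4 * pi"] by simp
      finally show "D {j l} (E l) \<le> 1 / 32 * (B l * (4 * pi))"
        using L[OF l(2)] B0[of l] by (simp add: abs_mult)
    qed simp
    also have "\<dots> = measure S2 (E l) * B l / 32" by simp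
    also have "\<dots> \<le> 4 / 32" using EB(2)[OF l(1)] by (intro divide_right_mono) auto
    finally show False by simp
  qed
  show ?thesis
  proof (intro conjI exI[of _ E] C1 C2 C3 allI impI exI[of _ e] exI[of _ \<mu>] exI[of _ j] e_basis ballI)
    fix l :: nat assume l: "1 \<le> l"
    show "E l \<in> sets S2" by (simp add: E_def band_sets)
    show "1/2 \<le> (LINT x:E l|S2. (cmod (f l x))\<^sup>2)" by (rule E_mass[OF l])
    fix x :: "real^3" assume "x \<in> sphere 0 1"
    then show "e (j l) x = f l x" by (rule ef[OF l])
  qed (rule sharp)
qed

end
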